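(* Let $\sigma$ and $\varphi$ be such that at least one of the following two sets of hypotheses (A), (B) holds. (A) $\sigma\in L_{\mathbb C}$, $\varphi:\mathbb C\to[-\infty,+\infty]$ is a proper closed convex function, and there are real constants $\nu_1,\nu_2$ such that for each $\varepsilon>0$ and each $z\in\Omega_\sigma$ there exists $(t^*,z^* )\in\partial_\varepsilon\varphi(z)$ (so $t^*\in\mathbb R$, $z^*\in\mathbb C$) satisfying both (b$_1$) $\mathrm{Im}\,(\mathcal Q(\mathrm{Im}(z^*\bar\sigma))u,u)_H\le\nu_1\,(Tu,u)_H$ for all $u\in\mathcal D(\mathcal Q(\sigma))$, and (b$_2$) $\varphi(\sigma)-\mathrm{Re}(z^*\bar\sigma)+t^*\in G_{\nu_2}$. (B) $\sigma\in L_{\mathbb R}$, $\varphi:\mathbb R\to[-\infty,+\infty]$ is a proper closed convex function, the operator $\mathcal Q(\sigma)$ is symmetric, and there is a real constant $\nu_2$ such that for each $\varepsilon>0$ and each $z\in\Omega_\sigma$ there exists $(t^*,z^* )\in\partial_\varepsilon\varphi(z)$ (so $t^*,z^*\in\mathbb R$) with $\varphi(\sigma)-z^*\sigma+t^*\in G_{\nu_2}$. In this case put $\nu_1:=0$. Assume moreover that $\mathcal Q(\varphi(\sigma))\in\mathfrak S_1$, that $T\in\mathfrak S_1$, and that at least one of the following two conditions is fulfilled: (c$_1$) $\varphi$ is nonnegative; (c$_2$) the set of the generalized eigenvectors of the operator $\mathcal Q(\sigma)$ is complete. Then the set $\Lambda^+_{\sigma,\varphi}:=\{\lambda\in\Lambda_\sigma:\varphi(\lambda)>0\}$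 is countable, each eigenvalue $\lambda\in\Lambda^+_{\sigma,\varphi}$ has a finite algebraic multiplicity, $\sum_{\lambda\in\Lambda^+_{\sigma,\varphi}}m(\lambda)\,\varphi(\lambda)<\infty$, and $$\sum_{\lambda\in\Lambda_\sigma}m(\lambda)\,\varphi(\lambda)\ \le\ \mathrm{Re}\,\mathrm{Tr}\,\mathcal Q(\varphi(\sigma))+(\nu_1+\nu_2)\,\mathrm{Tr}\,T .$$
   Context: Setting. $\Xi$ is a nonempty set; $L_{\mathbb C}$ is a linear space of complex-valued functions on $\Xi$ containing the constant functions and closed with respect to complex conjugation; $L_{\mathbb R}\subset L_{\mathbb C}$ is the subspace of real-valued functions. $H$ is a separable (complex) Hilbert space with inner product $(\cdot,\cdot)_H$, linear in the first argument. $\mathcal Q$ (a "quantization") is a linear map from $L_{\mathbb C}$ into the space of linear operators in $H$ such that $\mathcal Q(1)=I$ and $\mathcal D(\mathcal Q(\sigma))=\mathcal D(\mathcal Q(\mathrm{Re}\,\sigma))\cap\mathcal D(\mathcal Q(\mathrm{Im}\,\sigma))$, where $\mathcal D(\cdot)$ denotes the domain of an operator. For $\sigma\in L_{\mathbb C}$: $\Omega_\sigma=\{(\mathcal Q(\sigma)u,u)_H:u\in\mathcal D(\mathcal Q(\sigma)),\|u\|_H=1\}$ is the numerical range of $\mathcal Q(\sigma)$; $\Lambda_\sigma$ is the set of eigenvalues of $\mathcal Q(\sigma)$; $m(\lambda)\in\{1,2,\dots,\infty\}$ is the algebraic multiplicity of the eigenvalue $\lambda\in\Lambda_\sigma$,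 i.e. the dimension of $\bigcup_{n\ge1}\ker(\mathcal Q(\sigma)-\lambda)^n$; the nonzero elements of these spaces are the generalized eigenvectors. A set of vectors is complete if its closed linear span is $H$. An operator $A$ is symmetric if $(Au,v)_H=(u,Av)_H$ for all $u,v\in\mathcal D(A)$. $T$ is a fixed bounded operator in $H$. For $\nu\in\mathbb R$, $G_\nu$ is the set of functions $f\in L_{\mathbb R}$ such that $\mathrm{Re}\,(\mathcal Q(f)u,u)_H\ge-\nu\,(Tu,u)_H$ for all $u\in\mathcal D(\mathcal Q(f))$. $\mathfrak S_1$ is the trace class and $\mathrm{Tr}$ the trace. $\varphi(\sigma)$ denotes the composition $\varphi\circ\sigma$; the hypothesis $\mathcal Q(\varphi(\sigma))\in\mathfrak S_1$ includes that $\varphi(\sigma)$ belongs to $L_{\mathbb R}$. Convexity. A function $\varphi:X\to[-\infty,+\infty]$ on a locally convex real vector space $X$ is convex if its epigraph $\{(t,x)\in\mathbb R\times X:t\ge\varphi(x)\}$ is convex; a convex function is closed if its epigraph is closed, and proper if $|\varphi|\not\equiv\infty$. Here $X=\mathbb R$ (with $X^*=\mathbb R$, $\langle z^*,z\rangle=z^*z$) or $X=\mathbb C\cong\mathbb R^2$ (with $X^*=\mathbb C$, $\langle z^*,z\rangle=\mathrm{Re}(z^*\bar z)$). For $\varepsilon\ge0$ and $z_0\in X$, $\partial_\varepsilon\varphi(z_0)$ is the set of pairs $(t^*,z^* )\in\mathbb R\times X^*$ such that $\langle z^*,z\rangle-t^*\le\varphi(z)$ for all $z\in X$ and $\varphi(z_0)-\varepsilon\le\langle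 z^*,z_0\rangle-t^*$. Sums. "Countable" means at most countable. $\sum_{\lambda\in\Lambda_\sigma}m(\lambda)\varphi(\lambda)$ is the sum over $\Lambda^+_{\sigma,\varphi}$ plus the (possibly $-\infty$) sum over $\{\lambda\in\Lambda_\sigma:\varphi(\lambda)<0\}$; terms with $\varphi(\lambda)=0$ contribute $0$ even if $m(\lambda)=\infty$. The second sum is $-\infty$ if its index set is uncountable or contains an eigenvalue of infinite algebraic multiplicity.
   Formalization: The operator Q(σ) is additionally assumed densely defined (automatic under (c₂)); without this the claim fails under (c₁), e.g. when D(Q(σ))={0}, φ=0, T is a rank-one projection and ν₂=−1. *)

theory Defs
  imports "HOL-Analysis.Analysis"
begin

section \<open>Complex Hilbert spaces\<close>

text \<open>The complex inner product is linear in the first argument. Norm, topology, definiteness and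
  completeness come from the underlying real Hilbert space.\<close>

class complex_hilbert = real_inner + banach +
  fixes scaleC :: "complex \<Rightarrow> 'a \<Rightarrow> 'a"  (infixr \<open>*\<^sub>C\<close> 75)
    and cinner :: "'a \<Rightarrow> 'a \<Rightarrow> complex"
  assumes scaleC_add_right: "a *\<^sub>C (x + y) = a *\<^sub>C x + a *\<^sub>C y"
    and scaleC_add_left: "(a + b) *\<^sub>C x = a *\<^sub>C x + b *\<^sub>C x"
    and scaleC_scaleC: "a *\<^sub>C (b *\<^sub>C x) = (a * b) *\<^sub>C x"
    and scaleC_of_real: "complex_of_real r *\<^sub>C x = r *\<^sub>R x"
    and cinner_commute: "cinner x y = cnj (cinner y x)"
    and cinner_add_left: "cinner (x + y) z = cinner x z + cinner y z"
    and cinner_scaleC_left: "cinner (a *\<^sub>C x) y = a * cinner x y"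
    and inner_eq_Re_cinner: "x \<bullet> y = Re (cinner x y)"

lemma scaleC_one: "1 *\<^sub>C x = (x :: 'a :: complex_hilbert)"
  using scaleC_of_real[of 1 x] by simp

global_interpretation complex_vs:
    vector_space "scaleC :: complex \<Rightarrow> 'a \<Rightarrow> 'a :: complex_hilbert"
  defines cspan = complex_vs.span
    and cdim = complex_vs.dim
  by unfold_locales (simp_all add: scaleC_add_right scaleC_add_left scaleC_scaleC scaleC_one)

lemma cinner_self: "cinner x x = complex_of_real ((norm (x :: 'a :: complex_hilbert))\<^sup>2)"
proof (rule complex_eqI)
  show "Re (cinner x x) = Re (complex_of_real ((norm x)\<^sup>2))"
    by (simp add: inner_eq_Re_cinner[symmetric] power2_norm_eq_inner)
  have "Im (cinner x x) = - Im (cinner x x)"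
    using arg_cong[OF cinner_commute[of x x], of Im] by simp
  then show "Im (cinner x x) = Im (complex_of_real ((norm x)\<^sup>2))"
    by simp
qed

text \<open>The library dimension \<^const>\<open>cdim\<close> is \<open>0\<close> on infinite-dimensional subspaces.\<close>

definition cdim_ext :: "'h::complex_hilbert set \<Rightarrow> enat" where
  "cdim_ext V = (if \<exists>B. finite B \<and> V \<subseteq> cspan B then enat (cdim V) else \<infinity>)"

definition complete_system :: "'h::complex_hilbert set \<Rightarrow> bool" where
  "complete_system S \<longleftrightarrow> closure (cspan S) = UNIV"

definition orthonormal_basis :: "'h::complex_hilbert set \<Rightarrow> bool" where
  "orthonormal_basis E \<longleftrightarrow>
     (\<forall>e\<in>E. norm e = 1) \<and> (\<forall>e\<in>E. \<forall>f\<in>E. e \<noteq> f \<longrightarrow> cinner e f = 0) \<and> complete_system E"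


section \<open>Bounded operators, trace class, trace\<close>

definition bounded_operator :: "('h::complex_hilbert \<Rightarrow> 'h) \<Rightarrow> bool" where
  "bounded_operator A \<longleftrightarrow> bounded_linear A \<and> (\<forall>c u. A (c *\<^sub>C u) = c *\<^sub>C A u)"

text \<open>\<open>P\<close> is the modulus of \<open>A\<close>, i.e. the nonnegative square root of \<open>A\<^sup>* A\<close>; the operator
  \<open>A\<^sup>* A\<close> is determined by its sesquilinear form \<open>(A u, A v)\<close>.\<close>

definition is_modulus :: "('h::complex_hilbert \<Rightarrow> 'h) \<Rightarrow> ('h \<Rightarrow> 'h) \<Rightarrow> bool" where
  "is_modulus P A \<longleftrightarrow> bounded_operator P \<and>
     (\<forall>u. Im (cinner (P u) u) = 0 \<and> 0 \<le> Re (cinner (P u) u)) \<and>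
     (\<forall>u v. cinner (P (P u)) v = cinner (A u) (A v))"

definition trace_class :: "('h::complex_hilbert \<Rightarrow> 'h) \<Rightarrow> bool" where
  "trace_class A \<longleftrightarrow> bounded_operator A \<and>
     (\<exists>P E. is_modulus P A \<and> orthonormal_basis E \<and> (\<lambda>e. Re (cinner (P e) e)) summable_on E)"

definition op_trace :: "('h::complex_hilbert \<Rightarrow> 'h) \<Rightarrow> complex" where
  "op_trace A = (THE t. \<forall>E. orthonormal_basis E \<longrightarrow> ((\<lambda>e. cinner (A e) e) has_sum t) E)"


section \<open>Unbounded operators\<close>

text \<open>An operator in \<open>H\<close> is a partial function with domain \<^const>\<open>dom\<close>; the order \<^const>\<open>map_le\<close> is
  the extension relation for operators.\<close>

abbreviation op_apply :: "('h \<Rightarrow> 'h option) \<Rightarrow> 'h \<Rightarrow> 'h" where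
  "op_apply A u \<equiv> the (A u)"

definition linear_operator :: "('h::complex_hilbert \<Rightarrow> 'h option) \<Rightarrow> bool" where
  "linear_operator A \<longleftrightarrow> A 0 = Some 0 \<and>
     (\<forall>u\<in>dom A. \<forall>v\<in>dom A. A (u + v) = Some (op_apply A u + op_apply A v)) \<and>
     (\<forall>c. \<forall>u\<in>dom A. A (c *\<^sub>C u) = Some (c *\<^sub>C op_apply A u))"

text \<open>Density of the domain is not part of linearity. It is automatic when the generalized eigenvectors
  are complete, but trace inequalities involving the form of an operator on its domain need it in
  general: a form on \<open>{0}\<close> does not control the trace of a bounded operator.\<close>

definition densely_defined :: "('h::complex_hilbert \<Rightarrow> 'h option) \<Rightarrow> bool" where
  "densely_defined A \<longleftrightarrow> closure (dom A) = UNIV"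

definition symmetric_operator :: "('h::complex_hilbert \<Rightarrow> 'h option) \<Rightarrow> bool" where
  "symmetric_operator A \<longleftrightarrow>
     (\<forall>u\<in>dom A. \<forall>v\<in>dom A. cinner (op_apply A u) v = cinner u (op_apply A v))"

definition op_lincomb ::
  "complex \<Rightarrow> ('h::complex_hilbert \<Rightarrow> 'h option) \<Rightarrow> complex \<Rightarrow> ('h \<Rightarrow> 'h option) \<Rightarrow> ('h \<Rightarrow> 'h option)" where
  "op_lincomb a A b B = (\<lambda>u. if u \<in> dom A \<inter> dom B
     then Some (a *\<^sub>C op_apply A u + b *\<^sub>C op_apply B u) else None)"

primrec op_power :: "('h \<Rightarrow> 'h option) \<Rightarrow> nat \<Rightarrow> ('h \<Rightarrow> 'h option)" where
  "op_power A 0 = Some"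
| "op_power A (Suc n) = A \<circ>\<^sub>m op_power A n"

definition op_kernel :: "('h::complex_hilbert \<Rightarrow> 'h option) \<Rightarrow> 'h set" where
  "op_kernel A = {u. A u = Some 0}"

definition numerical_range :: "('h::complex_hilbert \<Rightarrow> 'h option) \<Rightarrow> complex set" where
  "numerical_range A = {cinner (op_apply A u) u |u. u \<in> dom A \<and> norm u = 1}"

definition eigenvalues :: "('h::complex_hilbert \<Rightarrow> 'h option) \<Rightarrow> complex set" where
  "eigenvalues A = {\<mu>. \<exists>u. u \<noteq> 0 \<and> A u = Some (\<mu> *\<^sub>C u)}"

definition generalized_eigenspace ::
  "('h::complex_hilbert \<Rightarrow> 'h option) \<Rightarrow> complex \<Rightarrow> 'h set" where
  "generalized_eigenspace A \<mu> = (\<Union>n\<in>{1..}. op_kernel (op_power (op_lincomb 1 A (- \<mu>) Some) n))"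

definition algebraic_multiplicity ::
  "('h::complex_hilbert \<Rightarrow> 'h option) \<Rightarrow> complex \<Rightarrow> enat" where
  "algebraic_multiplicity A \<mu> = cdim_ext (generalized_eigenspace A \<mu>)"

definition generalized_eigenvectors :: "('h::complex_hilbert \<Rightarrow> 'h option) \<Rightarrow> 'h set" where
  "generalized_eigenvectors A = (\<Union>\<mu>\<in>eigenvalues A. generalized_eigenspace A \<mu>) - {0}"

lemma symmetric_operator_eigenvalue_real:
  assumes "symmetric_operator A" and "\<mu> \<in> eigenvalues A"
  shows "\<mu> \<in> \<real>"
proof -
  obtain u where u: "u \<noteq> 0" "A u = Some (\<mu> *\<^sub>C u)"
    using assms(2) by (auto simp: eigenvalues_def)
  then have "cinner (\<mu> *\<^sub>C u) u = cinner u (\<mu> *\<^sub>C u)"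
    using assms(1) by (force simp: symmetric_operator_def)
  then have "\<mu> * cinner u u = cnj (\<mu> * cinner u u)"
    by (simp add: cinner_scaleC_left cinner_commute[of u "\<mu> *\<^sub>C u"])
  then have "\<mu> = cnj \<mu>"
    using u(1) by (simp add: cinner_self)
  then show ?thesis
    by (simp add: Reals_cnj_iff)
qed


section \<open>Quantizations\<close>

text \<open>Linearity of \<open>Q\<close> is understood for unbounded operators, as
  \<open>a Q(\<sigma>) + b Q(\<tau>) \<subseteq> Q(a \<sigma> + b \<tau>)\<close>, the left-hand side being defined on the intersection of the
  two domains. Equality cannot be required: \<open>Q(\<sigma>) - Q(\<sigma>)\<close> is defined on the domain of \<open>Q(\<sigma>)\<close> only,
  whereas \<open>Q(0) = Q(1) - Q(1)\<close> is defined everywhere.\<close>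

locale quantization =
  fixes L :: "('x \<Rightarrow> complex) set"
    and Q :: "('x \<Rightarrow> complex) \<Rightarrow> ('h::complex_hilbert \<Rightarrow> 'h option)"
  assumes const_mem: "(\<lambda>_. c) \<in> L"
    and add_mem: "\<lbrakk>\<sigma> \<in> L; \<tau> \<in> L\<rbrakk> \<Longrightarrow> (\<lambda>\<xi>. \<sigma> \<xi> + \<tau> \<xi>) \<in> L"
    and scale_mem: "\<sigma> \<in> L \<Longrightarrow> (\<lambda>\<xi>. c * \<sigma> \<xi>) \<in> L"
    and cnj_mem: "\<sigma> \<in> L \<Longrightarrow> (\<lambda>\<xi>. cnj (\<sigma> \<xi>)) \<in> L"
    and linear_operator_Q: "\<sigma> \<in> L \<Longrightarrow> linear_operator (Q \<sigma>)"
    and Q_lincomb: "\<lbrakk>\<sigma> \<in> L; \<tau> \<in> L\<rbrakk> \<Longrightarrow>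
      op_lincomb a (Q \<sigma>) b (Q \<tau>) \<subseteq>\<^sub>m Q (\<lambda>\<xi>. a * \<sigma> \<xi> + b * \<tau> \<xi>)"
    and Q_one: "Q (\<lambda>_. 1) = Some"
    and dom_Q: "\<sigma> \<in> L \<Longrightarrow>
      dom (Q \<sigma>) = dom (Q (\<lambda>\<xi>. complex_of_real (Re (\<sigma> \<xi>)))) \<inter>
                  dom (Q (\<lambda>\<xi>. complex_of_real (Im (\<sigma> \<xi>))))"

definition real_valued :: "('x \<Rightarrow> complex) set \<Rightarrow> ('x \<Rightarrow> complex) set" where
  "real_valued L = {f\<in>L. \<forall>\<xi>. f \<xi> \<in> \<real>}"

text \<open>The form \<open>(T u, u)\<close> enters through its real part. This is no change when it is real, as an
  inequality between \<open>(T u, u)\<close> and a real number presupposes, and keeps \<open>T\<close> an arbitrary bounded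
  operator otherwise.\<close>

definition garding_class ::
  "('x \<Rightarrow> complex) set \<Rightarrow> (('x \<Rightarrow> complex) \<Rightarrow> ('h::complex_hilbert \<Rightarrow> 'h option)) \<Rightarrow> ('h \<Rightarrow> 'h) \<Rightarrow> real
    \<Rightarrow> ('x \<Rightarrow> complex) set" where
  "garding_class L Q T \<nu> = {f \<in> real_valued L.
     \<forall>u\<in>dom (Q f). Re (cinner (op_apply (Q f) u) u) \<ge> - \<nu> * Re (cinner (T u) u)}"


section \<open>Convex functions with extended real values\<close>

definition closed_convex :: "('a::real_normed_vector \<Rightarrow> ereal) \<Rightarrow> bool" where
  "closed_convex \<phi> \<longleftrightarrow>
     convex {(t::real, x). \<phi> x \<le> ereal t} \<and> closed {(t::real, x). \<phi> x \<le> ereal t}"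

definition proper :: "('a \<Rightarrow> ereal) \<Rightarrow> bool" where
  "proper \<phi> \<longleftrightarrow> (\<exists>x. \<bar>\<phi> x\<bar> \<noteq> \<infinity>)"

definition eps_subdifferential ::
  "real \<Rightarrow> ('a::real_inner \<Rightarrow> ereal) \<Rightarrow> 'a \<Rightarrow> (real \<times> 'a) set" where
  "eps_subdifferential \<epsilon> \<phi> z0 =
     {(t, w). (\<forall>z. ereal (w \<bullet> z - t) \<le> \<phi> z) \<and> \<phi> z0 - ereal \<epsilon> \<le> ereal (w \<bullet> z0 - t)}"

text \<open>On \<^typ>\<open>complex\<close> the library inner product is the pairing of the real plane.\<close>

lemma inner_complex_eq: "w \<bullet> z = Re (w * cnj z)"
  by (simp add: inner_complex_def)

text \<open>The composition of \<open>\<phi>\<close> and \<open>\<sigma>\<close> as a complex-valued function; meaningful when \<open>\<phi>\<close> is finite on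
  the range of \<open>\<sigma>\<close>.\<close>

definition comp_fun :: "('a \<Rightarrow> ereal) \<Rightarrow> ('x \<Rightarrow> 'a) \<Rightarrow> 'x \<Rightarrow> complex" where
  "comp_fun \<phi> \<sigma> = (\<lambda>\<xi>. complex_of_real (real_of_ereal (\<phi> (\<sigma> \<xi>))))"

definition hypotheses_complex ::
  "('x \<Rightarrow> complex) set \<Rightarrow> (('x \<Rightarrow> complex) \<Rightarrow> ('h::complex_hilbert \<Rightarrow> 'h option)) \<Rightarrow> ('h \<Rightarrow> 'h)
    \<Rightarrow> ('x \<Rightarrow> complex) \<Rightarrow> (complex \<Rightarrow> ereal) \<Rightarrow> real \<Rightarrow> real \<Rightarrow> bool" where
  "hypotheses_complex L Q T \<sigma> \<phi> \<nu>1 \<nu>2 \<longleftrightarrow>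
     \<sigma> \<in> L \<and> proper \<phi> \<and> closed_convex \<phi> \<and>
     (\<forall>\<epsilon>>0. \<forall>z\<in>numerical_range (Q \<sigma>). \<exists>(t, w)\<in>eps_subdifferential \<epsilon> \<phi> z.
        (\<forall>u\<in>dom (Q \<sigma>).
           Im (cinner (op_apply (Q (\<lambda>\<xi>. complex_of_real (Im (w * cnj (\<sigma> \<xi>))))) u) u)
             \<le> \<nu>1 * Re (cinner (T u) u)) \<and>
        (\<lambda>\<xi>. comp_fun \<phi> \<sigma> \<xi> - complex_of_real (Re (w * cnj (\<sigma> \<xi>))) + complex_of_real t)
           \<in> garding_class L Q T \<nu>2)"

text \<open>Real-valued symbols remain functions into \<^typ>\<open>complex\<close>, and the numerical range of a symmetric
  operator is a set of real numbers of type \<^typ>\<open>complex\<close>; hence the conversions by \<^const>\<open>Re\<close>. For the same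
  reason a function \<open>\<psi>\<close> of a real variable is evaluated at eigenvalues and composed with real symbols
  as \<open>\<lambda>z. \<psi> (Re z)\<close>; see \<open>symmetric_operator_eigenvalue_real\<close>.\<close>

definition hypotheses_real ::
  "('x \<Rightarrow> complex) set \<Rightarrow> (('x \<Rightarrow> complex) \<Rightarrow> ('h::complex_hilbert \<Rightarrow> 'h option)) \<Rightarrow> ('h \<Rightarrow> 'h)
    \<Rightarrow> ('x \<Rightarrow> complex) \<Rightarrow> (real \<Rightarrow> ereal) \<Rightarrow> real \<Rightarrow> bool" where
  "hypotheses_real L Q T \<sigma> \<phi> \<nu>2 \<longleftrightarrow>
     \<sigma> \<in> real_valued L \<and> proper \<phi> \<and> closed_convex \<phi> \<and> symmetric_operator (Q \<sigma>) \<and>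
     (\<forall>\<epsilon>>0. \<forall>z\<in>numerical_range (Q \<sigma>). \<exists>(t, w)\<in>eps_subdifferential \<epsilon> \<phi> (Re z).
        (\<lambda>\<xi>. comp_fun \<phi> (\<lambda>\<xi>. Re (\<sigma> \<xi>)) \<xi> - complex_of_real w * \<sigma> \<xi> + complex_of_real t)
           \<in> garding_class L Q T \<nu>2)"


section \<open>Sums over eigenvalues\<close>

definition positive_part ::
  "('h::complex_hilbert \<Rightarrow> 'h option) \<Rightarrow> (complex \<Rightarrow> ereal) \<Rightarrow> complex set" where
  "positive_part A \<phi> = {\<mu>\<in>eigenvalues A. \<phi> \<mu> > 0}"

definition negative_part ::
  "('h::complex_hilbert \<Rightarrow> 'h option) \<Rightarrow> (complex \<Rightarrow> ereal) \<Rightarrow> complex set" where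
  "negative_part A \<phi> = {\<mu>\<in>eigenvalues A. \<phi> \<mu> < 0}"

text \<open>Sums of \<^typ>\<open>ereal\<close> terms of constant sign always exist: they are the supremum, respectively the
  infimum, of the finite partial sums. In particular the sum of uncountably many negative terms,
  or with a term of infinite multiplicity, is \<open>-\<infinity>\<close>.\<close>

definition eigenvalue_sum ::
  "('h::complex_hilbert \<Rightarrow> 'h option) \<Rightarrow> (complex \<Rightarrow> ereal) \<Rightarrow> complex set \<Rightarrow> ereal" where
  "eigenvalue_sum A \<phi> S = (\<Sum>\<^sub>\<infinity>\<mu>\<in>S. ereal_of_enat (algebraic_multiplicity A \<mu>) * \<phi> \<mu>)"

lemma nonpos_infsum_ereal:
  fixes f :: "'a \<Rightarrow> ereal"
  assumes "\<And>x. x \<in> A \<Longrightarrow> f x \<le> 0"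
  shows "(f has_sum (INF F\<in>{F. finite F \<and> F \<subseteq> A}. sum f F)) A"
    and "infsum f A = (INF F\<in>{F. finite F \<and> F \<subseteq> A}. sum f F)"
proof -
  let ?I = "INF F\<in>{F. finite F \<and> F \<subseteq> A}. sum f F"
  have anti: "sum f G \<le> sum f F" if "finite G" "F \<subseteq> G" "G \<subseteq> A" for F G
  proof -
    have "sum f G = sum f F + sum f (G - F)"
      using that by (metis sum.subset_diff add.commute)
    also have "\<dots> \<le> sum f F + 0"
      using that assms by (intro add_left_mono sum_nonpos) auto
    finally show ?thesis by simp
  qed
  have "(sum f \<longlongrightarrow> ?I) (finite_subsets_at_top A)"
  proof (rule order_tendstoI)
    fix a assume a: "a < ?I"
    have "a < sum f F" if "finite F" "F \<subseteq> A" for F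
    proof -
      have "?I \<le> sum f F"
        by (rule INF_lower) (use that in blast)
      with a show ?thesis by (rule less_le_trans)
    qed
    then show "eventually (\<lambda>F. a < sum f F) (finite_subsets_at_top A)"
      by (intro eventually_finite_subsets_at_top_weakI)
  next
    fix a assume "?I < a"
    then obtain F where F: "finite F" "F \<subseteq> A" "sum f F < a"
      unfolding INF_less_iff by blast
    have "sum f G < a" if "finite G" "F \<subseteq> G" "G \<subseteq> A" for G
      using anti[OF that] F(3) by (rule le_less_trans)
    with F(1,2) show "eventually (\<lambda>F. sum f F < a) (finite_subsets_at_top A)"
      unfolding eventually_finite_subsets_at_top by blast
  qed
  then show "(f has_sum ?I) A"
    by (simp add: has_sum_def)
  then show "infsum f A = ?I"
    by (rule infsumI)
qed

end

theory Submission
  imports Defs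
begin

text \<open>For a unit vector \<open>u\<close> in the domain of \<open>A = Q(\<sigma>)\<close>, the \<open>\<epsilon>\<close>-subgradients at \<open>z = (A u, u)\<close> give
  \<open>\<phi>(A u, u) \<le> s(u) := Re (B u, u) + (\<nu>\<^sub>1 + \<nu>\<^sub>2) Re (T u, u)\<close> with \<open>B = Q(\<phi>(\<sigma>))\<close>.
  Adding generalized eigenvectors one at a time and orthonormalising produces finite orthonormal sets
  \<open>F\<close> with \<open>A\<close>-invariant span on which \<open>A\<close> is triangular, so that the numbers \<open>(A f, f)\<close> are the
  eigenvalues of \<open>A\<close> on the span of \<open>F\<close>, counted with multiplicity; hence the sum of \<open>\<phi>\<close> over these
  eigenvalues is at most \<open>\<Sum>\<^bsub>f\<in>F\<^esub> s(f)\<close>. This is uniformly bounded, as \<open>B\<close> and \<open>T\<close> are trace class, which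
  settles the positive part of the sum. As the span of \<open>F\<close> grows, \<open>\<Sum>\<^bsub>f\<in>F\<^esub> s(f)\<close> tends to the trace;
  the span can be enlarged within the triangular sets if the generalized eigenvectors are complete,
  and by arbitrary vectors if \<open>\<phi> \<ge> 0\<close>, because then \<open>s \<ge> 0\<close>.\<close>

section \<open>Positive semidefinite sesquilinear forms\<close>

text \<open>Positivity without definiteness: besides the inner product, the form
  \<open>cinner (P x) y\<close> of a modulus \<open>P\<close> is an instance, and it may vanish on
  nonzero vectors.\<close>

locale psd_form =
  fixes h :: "'h::complex_hilbert \<Rightarrow> 'h \<Rightarrow> complex"
  assumes add_left: "h (x + y) z = h x z + h y z"
    and scale_left: "h (c *\<^sub>C x) z = c * h x z"
    and commute: "h x y = cnj (h y x)"
    and nonneg: "0 \<le> Re (h x x)"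
begin

lemma zero_left [simp]: "h 0 y = 0"
  using add_left[of 0 0 y] by simp

lemma zero_right [simp]: "h x 0 = 0"
  using commute[of x 0] by simp

lemma add_right: "h x (y + z) = h x y + h x z"
  using commute[of x "y + z"] commute[of x y] commute[of x z] by (simp add: add_left)

lemma scale_right: "h x (c *\<^sub>C y) = cnj c * h x y"
  using commute[of x "c *\<^sub>C y"] commute[of x y] by (simp add: scale_left)

lemma minus_left: "h (- x) y = - h x y"
  using add_left[of x "- x" y] by (simp add: eq_neg_iff_add_eq_0 add.commute)

lemma minus_right: "h x (- y) = - h x y"
  using commute[of x "- y"] commute[of x y] by (simp add: minus_left)

lemma diff_left: "h (x - y) z = h x z - h y z"
  using add_left[of x "- y" z] by (simp add: minus_left)

lemma diff_right: "h x (y - z) = h x y - h x z"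
  using add_right[of x y "- z"] by (simp add: minus_right)

lemma sum_left: "h (\<Sum>i\<in>I. f i) y = (\<Sum>i\<in>I. h (f i) y)"
  by (induction I rule: infinite_finite_induct) (auto simp: add_left)

lemma sum_right: "h x (\<Sum>i\<in>I. f i) = (\<Sum>i\<in>I. h x (f i))"
  by (induction I rule: infinite_finite_induct) (auto simp: add_right)

lemma self_real: "h x x = complex_of_real (Re (h x x))"
  using commute[of x x] by (metis Reals_cnj_iff of_real_Re)

lemma mult_commute_norm: "h x y * h y x = complex_of_real ((norm (h x y))\<^sup>2)"
  using commute[of y x] complex_norm_square[of "h x y"] by simp

text \<open>Nonnegativity of \<open>h\<close> at \<open>y - (s * h y x) *\<^sub>C x\<close> is a
  quadratic inequality in the real \<open>s\<close>. For \<open>a \<noteq> 0\<close> the choice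
  \<open>s = 1 / a\<close> gives the claim. For \<open>a = 0\<close> the inequality is affine in
  \<open>s\<close>, and \<open>s = (b + 1) / n\<close> would violate it unless
  \<open>n = 0\<close>.\<close>

lemma Cauchy_Schwarz: "(norm (h x y))\<^sup>2 \<le> Re (h x x) * Re (h y y)"
proof -
  define a where "a = Re (h x x)"
  define b where "b = Re (h y y)"
  define n where "n = (norm (h x y))\<^sup>2"
  have a0: "0 \<le> a" and b0: "0 \<le> b" by (simp_all add: a_def b_def nonneg)
  have quad: "0 \<le> b - 2 * s * n + s\<^sup>2 * n * a" for s :: real
  proof -
    define c where "c = complex_of_real s * h y x"
    have cn: "cnj (h y x) = h x y" using commute[of x y] by (rule sym)
    have yx: "h y x * h x y = complex_of_real n"
      using mult_commute_norm[of x y] by (simp add: n_def mult.commute)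
    have "h (y - c *\<^sub>C x) (y - c *\<^sub>C x)
        = h y y - c * h x y - cnj c * h y x + c * cnj c * h x x"
      by (simp add: diff_left diff_right scale_left scale_right algebra_simps)
    also have "c * h x y = complex_of_real (s * n)"
      using yx by (simp add: c_def mult_ac)
    also have "cnj c * h y x = complex_of_real (s * n)"
      using yx by (simp add: c_def cn mult_ac)
    also have "c * cnj c = complex_of_real (s\<^sup>2 * n)"
      using yx by (simp add: c_def cn mult_ac power2_eq_square)
    finally have "Re (h (y - c *\<^sub>C x) (y - c *\<^sub>C x)) = b - 2 * s * n + s\<^sup>2 * n * a"
      by (simp add: a_def b_def)
    then show ?thesis using nonneg[of "y - c *\<^sub>C x"] by simp
  qed
  have "n \<le> a * b"
  proof (cases "a = 0")
    case True
    have "n = 0"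
    proof (rule ccontr)
      assume "n \<noteq> 0"
      then have "0 \<le> b - 2 * ((b + 1) / n) * n"
        using quad[of "(b + 1) / n"] True by simp
      then show False using \<open>n \<noteq> 0\<close> b0 by simp
    qed
    then show ?thesis using True by simp
  next
    case False
    then have "0 \<le> b - n / a"
      using quad[of "1 / a"] by (simp add: power2_eq_square field_simps)
    then show ?thesis using False a0 by (simp add: field_simps)
  qed
  then show ?thesis by (simp add: n_def a_def b_def)
qed

text \<open>The parallelogram identity with the nonnegative term at \<open>x - y\<close> dropped; it
  acts as a triangle inequality for the squared seminorm.\<close>

lemma self_add_le: "Re (h (x + y) (x + y)) \<le> 2 * Re (h x x) + 2 * Re (h y y)"
proof -
  have "Re (h (x + y) (x + y)) + Re (h (x - y) (x - y)) = 2 * Re (h x x) + 2 * Re (h y y)"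
    by (simp add: add_left add_right diff_left diff_right)
  then show ?thesis using nonneg[of "x - y"] by simp
qed

section \<open>Orthonormal systems and Gram-Schmidt for a semidefinite form\<close>

definition orthonormal :: "'h set \<Rightarrow> bool" where
  "orthonormal F \<longleftrightarrow> (\<forall>f\<in>F. \<forall>g\<in>F. h f g = (if f = g then 1 else 0))"

text \<open>A Fourier sum, which is an orthogonal projection onto \<open>cspan F\<close> when
  \<open>F\<close> is finite and orthonormal; over an infinite \<open>F\<close> the sum is 0 by
  convention.\<close>

definition proj :: "'h set \<Rightarrow> 'h \<Rightarrow> 'h" where
  "proj F x = (\<Sum>f\<in>F. h x f *\<^sub>C f)"

lemma orthonormal_empty [simp]: "orthonormal {}"
  by (simp add: orthonormal_def)

lemma orthonormal_subset: "orthonormal F \<Longrightarrow> G \<subseteq> F \<Longrightarrow> orthonormal G"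
  unfolding orthonormal_def by blast

lemma proj_in_span: "proj F x \<in> cspan F"
  unfolding proj_def by (intro complex_vs.span_sum complex_vs.span_scale complex_vs.span_base)

lemma proj_orthogonal:
  assumes "finite F" "orthonormal F" "f \<in> F"
  shows "h (x - proj F x) f = 0"
proof -
  have "h (proj F x) f = (\<Sum>g\<in>F. h x g * (if g = f then 1 else 0))"
    unfolding proj_def sum_left scale_left using assms(2,3)
    by (intro sum.cong) (auto simp: orthonormal_def)
  also have "\<dots> = h x f" using assms(1,3) by (simp add: if_distrib cong: if_cong)
  finally show ?thesis by (simp add: diff_left)
qed

lemma orthogonal_span:
  assumes "\<And>f. f \<in> F \<Longrightarrow> h x f = 0" and "y \<in> cspan F"
  shows "h x y = 0"
  using assms(2)
  by (induction rule: complex_vs.span_induct_alt) (auto simp: add_right scale_right assms(1))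

lemma proj_orthogonal_span:
  assumes "finite F" "orthonormal F" "y \<in> cspan F"
  shows "h (x - proj F x) y = 0"
  using orthogonal_span[OF proj_orthogonal[OF assms(1,2)] assms(3)] .

text \<open>The vector \<open>proj F x - y\<close> lies in \<open>cspan F\<close>, to which
  \<open>x - proj F x\<close> is orthogonal.\<close>

lemma Pythagoras:
  assumes "finite F" "orthonormal F" "y \<in> cspan F"
  shows "Re (h (x - y) (x - y)) = Re (h (x - proj F x) (x - proj F x)) + Re (h (proj F x - y) (proj F x - y))"
proof -
  let ?a = "x - proj F x" and ?b = "proj F x - y"
  have ab: "h ?a ?b = 0"
    using assms by (intro proj_orthogonal_span complex_vs.span_diff proj_in_span)
  moreover have "h ?b ?a = 0" using ab commute[of ?b ?a] by simp
  ultimately have "h (?a + ?b) (?a + ?b) = h ?a ?a + h ?b ?b" by (simp only: add_left add_right) simp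
  then show ?thesis by simp
qed

lemma proj_minimal:
  assumes "finite F" "orthonormal F" "y \<in> cspan F"
  shows "Re (h (x - proj F x) (x - proj F x)) \<le> Re (h (x - y) (x - y))"
  using Pythagoras[OF assms, of x] nonneg[of "proj F x - y"] by simp

lemma self_proj:
  assumes "finite F" "orthonormal F"
  shows "Re (h (proj F x) (proj F x)) = (\<Sum>f\<in>F. (norm (h x f))\<^sup>2)"
proof -
  have "h (proj F x) (proj F x) = h x (proj F x)"
    using proj_orthogonal_span[OF assms proj_in_span, of x x] by (simp add: diff_left)
  also have "\<dots> = (\<Sum>f\<in>F. complex_of_real ((norm (h x f))\<^sup>2))"
    unfolding proj_def sum_right scale_right by (simp only: complex_norm_square mult.commute)
  finally show ?thesis by simp
qed

lemma Bessel_eq: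
  assumes "finite F" "orthonormal F"
  shows "Re (h (x - proj F x) (x - proj F x)) = Re (h x x) - (\<Sum>f\<in>F. (norm (h x f))\<^sup>2)"
  using Pythagoras[OF assms complex_vs.span_zero, of x] self_proj[OF assms, of x] by simp

lemma Bessel:
  assumes "finite F" "orthonormal F"
  shows "(\<Sum>f\<in>F. (norm (h x f))\<^sup>2) \<le> Re (h x x)"
  using Bessel_eq[OF assms, of x] nonneg[of "x - proj F x"] by simp

text \<open>At a null vector the factor is \<open>1 / 0 = 0\<close>, so unit length is obtained only
  where \<open>Re (h x x) \<noteq> 0\<close>.\<close>

definition normalize :: "'h \<Rightarrow> 'h" where
  "normalize x = complex_of_real (1 / sqrt (Re (h x x))) *\<^sub>C x"

lemma orthonormal_insert_normalize:
  assumes "finite F" "orthonormal F" "Re (h (v - proj F v) (v - proj F v)) \<noteq> 0"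
  shows "orthonormal (insert (normalize (v - proj F v)) F)"
    and "normalize (v - proj F v) \<notin> F"
proof -
  define r where "r = v - proj F v"
  define e where "e = normalize r"
  have r: "0 < Re (h r r)" using assms(3) nonneg[of r] by (simp add: r_def)
  have ee: "h e e = 1"
  proof -
    have "h e e = complex_of_real (1 / Re (h r r)) * h r r"
      using r by (simp add: e_def normalize_def scale_left scale_right flip: of_real_mult)
    also have "\<dots> = complex_of_real (1 / Re (h r r) * Re (h r r))"
      by (subst self_real) (simp only: of_real_mult)
    finally show ?thesis using r by simp
  qed
  have ef: "h e f = 0" if "f \<in> F" for f
    using proj_orthogonal[OF assms(1,2) that] by (simp add: e_def normalize_def scale_left r_def)
  then have "h f e = 0" if "f \<in> F" for f using commute[of f e] that by simp
  moreover have "e \<notin> F" using ee ef by fastforce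
  ultimately show "orthonormal (insert (normalize (v - proj F v)) F)"
    and "normalize (v - proj F v) \<notin> F"
    using assms(2) ee ef unfolding r_def[symmetric] e_def[symmetric] orthonormal_def by auto
qed

text \<open>For a degenerate form the residual \<open>v - proj F v\<close> can be a nonzero null
  vector, which cannot be normalized. Then \<open>F\<close> is kept and \<open>v\<close> is matched
  only up to seminorm 0, which is why a separate \<open>y\<close> appears.\<close>

lemma Gram_Schmidt_step:
  assumes "finite F" "orthonormal F"
  obtains F' y where "finite F'" "orthonormal F'" "F \<subseteq> F'" "y \<in> cspan F'"
    "Re (h (v - y) (v - y)) = 0"
proof (cases "Re (h (v - proj F v) (v - proj F v)) = 0")
  case True
  then show ?thesis using that[of F "proj F v"] assms proj_in_span by blast
next
  case False
  define e where "e = normalize (v - proj F v)"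
  define c where "c = complex_of_real (sqrt (Re (h (v - proj F v) (v - proj F v))))"
  have "c \<noteq> 0" using False nonneg by (simp add: c_def)
  then have "c *\<^sub>C e = v - proj F v"
    by (simp add: e_def normalize_def c_def scaleC_scaleC scaleC_one)
  then have "v = c *\<^sub>C e + proj F v" by simp
  also have "\<dots> \<in> cspan (insert e F)"
    using proj_in_span[of F v] complex_vs.span_mono[of F "insert e F", OF subset_insertI]
    by (intro complex_vs.span_add complex_vs.span_scale complex_vs.span_base[of e]) auto
  finally have "v \<in> cspan (insert e F)" .
  moreover have "orthonormal (insert e F)"
    using orthonormal_insert_normalize(1)[OF assms False] by (simp add: e_def)
  ultimately show ?thesis
    using assms(1) by (intro that[of "insert e F" v]) auto
qed

end

section \<open>The inner product as a definite form, and Parseval's identity\<close>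

global_interpretation cinner: psd_form "cinner :: 'h::complex_hilbert \<Rightarrow> _"
proof
  show "cinner x y = cnj (cinner y x)" for x y :: 'h by (rule cinner_commute)
qed (simp_all add: cinner_add_left cinner_scaleC_left cinner_self)

lemma Re_cinner_self: "Re (cinner x x) = (norm x)\<^sup>2"
  by (simp add: cinner_self)

lemma norm_cinner_le: "norm (cinner x y) \<le> norm x * norm y"
proof (rule power2_le_imp_le)
  show "(norm (cinner x y))\<^sup>2 \<le> (norm x * norm y)\<^sup>2"
    using cinner.Cauchy_Schwarz[of x y] unfolding Re_cinner_self power_mult_distrib .
qed simp

lemma bounded_linear_cinner_left: "bounded_linear (\<lambda>x. cinner x y)"
proof (rule bounded_linear_intro[where K = "norm y"])
  show "cinner (r *\<^sub>R x) y = r *\<^sub>R cinner x y" for r x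
    using cinner_scaleC_left[of "complex_of_real r" x y] by (simp add: scaleC_of_real scaleR_conv_of_real)
qed (simp_all add: cinner_add_left norm_cinner_le)

lemma cinner_orthonormal_norm:
  assumes "cinner.orthonormal F" "f \<in> F"
  shows "norm f = 1"
proof -
  have "cinner f f = 1" using assms unfolding cinner.orthonormal_def by metis
  then have "(norm f)\<^sup>2 = 1" using Re_cinner_self[of f] by simp
  then show ?thesis using norm_ge_zero[of f] unfolding abs_square_eq_1 by simp
qed

lemma cinner_proj_span:
  assumes "finite F" "cinner.orthonormal F" "x \<in> cspan F"
  shows "cinner.proj F x = x"
proof -
  have "(norm (x - cinner.proj F x))\<^sup>2 \<le> 0"
    using cinner.proj_minimal[OF assms, of x] unfolding Re_cinner_self by simp
  then show ?thesis by simp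
qed

lemma norm_cinner_proj_le:
  assumes "finite F" "cinner.orthonormal F"
  shows "norm (cinner.proj F x) \<le> norm x"
proof (rule power2_le_imp_le)
  show "(norm (cinner.proj F x))\<^sup>2 \<le> (norm x)\<^sup>2"
    using cinner.Bessel[OF assms, of x] cinner.self_proj[OF assms, of x]
    unfolding Re_cinner_self by linarith
qed simp

text \<open>Lets an orthonormal set absorb arbitrary vectors. This is the enlargement used for
  nonnegative \<open>\<phi>\<close>, where the span of the larger set may fail to be
  invariant.\<close>

lemma cinner_Gram_Schmidt:
  assumes "finite F" "cinner.orthonormal F" "finite V"
  obtains F' where "finite F'" "cinner.orthonormal F'" "F \<subseteq> F'" "V \<subseteq> cspan F'"
proof -
  have "\<exists>F'. finite F' \<and> cinner.orthonormal F' \<and> F \<subseteq> F' \<and> V \<subseteq> cspan F'"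
    using assms(3)
  proof (induction V rule: finite_induct)
    case empty
    then show ?case using assms by blast
  next
    case (insert v V)
    then obtain F1 where F1: "finite F1" "cinner.orthonormal F1" "F \<subseteq> F1" "V \<subseteq> cspan F1"
      by blast
    obtain F2 y where F2: "finite F2" "cinner.orthonormal F2" "F1 \<subseteq> F2" "y \<in> cspan F2"
      "Re (cinner (v - y) (v - y)) = 0"
      using cinner.Gram_Schmidt_step[OF F1(1,2)] by blast
    then have "v \<in> cspan F2" by (simp add: Re_cinner_self)
    moreover have "V \<subseteq> cspan F2" using F1(4) complex_vs.span_mono[OF F2(3)] by blast
    ultimately show ?case using F1(3) F2(1-3) by blast
  qed
  then show ?thesis using that by blast
qed

lemma orthonormal_basis_orthonormal: "orthonormal_basis E \<Longrightarrow> cinner.orthonormal E"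
  unfolding orthonormal_basis_def cinner.orthonormal_def by (simp add: cinner_self)

lemma span_finite_subset:
  assumes "x \<in> cspan E"
  obtains F where "finite F" "F \<subseteq> E" "x \<in> cspan F"
proof -
  obtain t r where t: "finite t" "t \<subseteq> E" "x = (\<Sum>a\<in>t. r a *\<^sub>C a)"
    using assms unfolding complex_vs.span_explicit by blast
  have "x \<in> cspan t"
    unfolding t(3) by (intro complex_vs.span_sum complex_vs.span_scale complex_vs.span_base)
  with that t(1,2) show ?thesis by blast
qed

lemma has_sum_distI:
  fixes f :: "'a \<Rightarrow> 'b::{metric_space, comm_monoid_add}"
  assumes "\<And>\<epsilon>. 0 < \<epsilon> \<Longrightarrow> \<exists>X. finite X \<and> X \<subseteq> A \<and> (\<forall>Y. finite Y \<and> X \<subseteq> Y \<and> Y \<subseteq> A \<longrightarrow> dist (sum f Y) l < \<epsilon>)"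
  shows "(f has_sum l) A"
  unfolding has_sum_def tendsto_iff eventually_finite_subsets_at_top using assms by blast

text \<open>A vector \<open>y\<close> of the dense span close to \<open>x\<close> lies in the span
  of a finite part of \<open>E\<close>. Every larger finite part approximates \<open>x\<close> at
  least as well, and the squared distance of \<open>x\<close> from its projection is the defect in
  Bessel's inequality.\<close>

lemma Parseval:
  assumes "orthonormal_basis E"
  shows "((\<lambda>e. (norm (cinner x e))\<^sup>2) has_sum (norm x)\<^sup>2) E"
proof (rule has_sum_distI)
  fix \<epsilon> :: real assume "0 < \<epsilon>"
  note on = orthonormal_basis_orthonormal[OF assms]
  have "x \<in> closure (cspan E)"
    using assms by (simp add: orthonormal_basis_def complete_system_def)
  then obtain y where y: "y \<in> cspan E" "dist y x < sqrt \<epsilon>"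
    using \<open>0 < \<epsilon>\<close> unfolding closure_approachable by (meson real_sqrt_gt_zero)
  obtain F where F: "finite F" "F \<subseteq> E" "y \<in> cspan F"
    using span_finite_subset[OF y(1)] .
  have "dist (\<Sum>e\<in>G. (norm (cinner x e))\<^sup>2) ((norm x)\<^sup>2) < \<epsilon>"
    if G: "finite G" "F \<subseteq> G" "G \<subseteq> E" for G
  proof -
    have onG: "cinner.orthonormal G" using cinner.orthonormal_subset[OF on G(3)] .
    have "y \<in> cspan G" using F(3) complex_vs.span_mono[OF G(2)] by blast
    from cinner.proj_minimal[OF G(1) onG this, of x] cinner.Bessel_eq[OF G(1) onG, of x]
    have "(norm x)\<^sup>2 - (\<Sum>e\<in>G. (norm (cinner x e))\<^sup>2) \<le> (norm (x - y))\<^sup>2"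
      unfolding Re_cinner_self by linarith
    also have "\<dots> < (sqrt \<epsilon>)\<^sup>2"
      using y(2) by (intro power_strict_mono) (simp_all add: dist_norm norm_minus_commute)
    also have "\<dots> = \<epsilon>" using \<open>0 < \<epsilon>\<close> by simp
    finally show ?thesis
      using cinner.Bessel[OF G(1) onG, of x] by (simp add: dist_real_def Re_cinner_self)
  qed
  then show "\<exists>X. finite X \<and> X \<subseteq> E \<and> (\<forall>Y. finite Y \<and> X \<subseteq> Y \<and> Y \<subseteq> E \<longrightarrow>
      dist (\<Sum>e\<in>Y. (norm (cinner x e))\<^sup>2) ((norm x)\<^sup>2) < \<epsilon>)"
    using F(1,2) by blast
qed

section \<open>Trace class operators\<close>

lemma has_sum_finite_sum:
  fixes f :: "'i \<Rightarrow> 'j \<Rightarrow> 'b::topological_comm_monoid_add"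
  assumes "\<And>i. i \<in> J \<Longrightarrow> (f i has_sum S i) A"
  shows "((\<lambda>x. \<Sum>i\<in>J. f i x) has_sum (\<Sum>i\<in>J. S i)) A"
  using assms by (induction J rule: infinite_finite_induct) (auto intro: has_sum_add)

text \<open>A nuclear representation: \<open>A\<close> is an absolutely convergent series of rank
  one operators. Its trace and its compressions become scalar series over \<open>I\<close>,
  controlled by \<open>norm (a i) * norm (b i)\<close>.\<close>

locale nuclear =
  fixes A :: "'h::complex_hilbert \<Rightarrow> 'h" and I :: "'i set" and a b :: "'i \<Rightarrow> 'h"
  assumes summable: "(\<lambda>i. norm (a i) * norm (b i)) summable_on I"
    and expansion: "((\<lambda>i. cinner u (a i) *\<^sub>C b i) has_sum A u) I"
begin

definition tr :: complex where
  "tr = (\<Sum>\<^sub>\<infinity>i\<in>I. cinner (b i) (a i))"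

lemma has_sum_tr: "((\<lambda>i. cinner (b i) (a i)) has_sum tr) I"
proof -
  have "(\<lambda>i. norm (cinner (b i) (a i))) summable_on I"
    using summable by (rule summable_on_comparison_test) (auto intro: order_trans[OF norm_cinner_le] simp: mult.commute)
  then show ?thesis
    unfolding tr_def by (intro has_sum_infsum) (rule abs_summable_summable)
qed

text \<open>Inserting the expansion of each \<open>A f\<close> and exchanging the finite sum with
  the series collects, for each \<open>i\<close>, the projection of \<open>b i\<close>.\<close>

lemma has_sum_compression:
  assumes "finite F"
  shows "((\<lambda>i. cinner (cinner.proj F (b i)) (a i)) has_sum (\<Sum>f\<in>F. cinner (A f) f)) I"
proof -
  have "((\<lambda>i. \<Sum>f\<in>F. cinner (cinner f (a i) *\<^sub>C b i) f) has_sum (\<Sum>f\<in>F. cinner (A f) f)) I"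
    by (intro has_sum_finite_sum has_sum_bounded_linear[OF bounded_linear_cinner_left expansion, unfolded o_def])
  moreover have "(\<Sum>f\<in>F. cinner (cinner f (a i) *\<^sub>C b i) f) = cinner (cinner.proj F (b i)) (a i)" for i
    unfolding cinner.proj_def cinner.sum_left cinner.scale_left by (simp add: mult.commute)
  ultimately show ?thesis by simp
qed

text \<open>Projections do not increase norms, so the series is dominated termwise, with a bound
  independent of \<open>F\<close>.\<close>

lemma compression_bound:
  assumes "finite F" "cinner.orthonormal F"
  shows "norm (\<Sum>f\<in>F. cinner (A f) f) \<le> (\<Sum>\<^sub>\<infinity>i\<in>I. norm (a i) * norm (b i))"
proof (rule norm_infsum_le[OF has_sum_compression[OF assms(1)] has_sum_infsum[OF summable]])
  fix i
  have "norm (cinner (cinner.proj F (b i)) (a i)) \<le> norm (cinner.proj F (b i)) * norm (a i)"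
    by (rule norm_cinner_le)
  also have "\<dots> \<le> norm (b i) * norm (a i)"
    by (intro mult_right_mono norm_cinner_proj_le assms) simp
  finally show "norm (cinner (cinner.proj F (b i)) (a i)) \<le> norm (a i) * norm (b i)"
    by (simp add: mult.commute)
qed

text \<open>The traces of the compressions to finite-dimensional subspaces converge along the net of these
  subspaces, and subspaces of a dense set are cofinal up to an arbitrarily small error.\<close>

lemma compression_approx:
  assumes D: "closure D = UNIV" and "0 < \<epsilon>"
  obtains F0 where "finite F0" "F0 \<subseteq> D"
    "\<And>F. \<lbrakk>finite F; cinner.orthonormal F; F0 \<subseteq> cspan F\<rbrakk> \<Longrightarrow> norm ((\<Sum>f\<in>F. cinner (A f) f) - tr) < \<epsilon>"
proof -
  define c where "c = (\<lambda>i. norm (a i) * norm (b i))"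
  have "(c has_sum infsum c I) I" using summable by (simp add: c_def)
  then obtain K where K: "finite K" "K \<subseteq> I"
    and Kc: "dist (sum c K) (infsum c I) < \<epsilon> / 8"
    using \<open>0 < \<epsilon>\<close> unfolding has_sum_def tendsto_iff eventually_finite_subsets_at_top
    by (meson order_refl divide_pos_pos zero_less_numeral)
  have tail: "infsum c (I - K) < \<epsilon> / 8"
    using Kc K summable infsum_Diff[of c I K]
    by (simp add: dist_real_def c_def abs_if split: if_splits)
  \<comment> \<open>The summand 1 keeps \<open>M\<close> positive when all relevant
    \<open>a i\<close> vanish. With the \<open>\<delta>\<close> below, the indices in
    \<open>K\<close> contribute at most \<open>2 * \<delta> * M = \<epsilon> / 4\<close> and the
    others less than \<open>2 * (\<epsilon> / 8)\<close>.\<close>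
  define M where "M = (\<Sum>i\<in>K. norm (a i)) + 1"
  have M: "0 < M" by (simp add: M_def add_nonneg_pos sum_nonneg)
  define \<delta> where "\<delta> = \<epsilon> / (8 * M)"
  have \<delta>: "0 < \<delta>" using M \<open>0 < \<epsilon>\<close> by (simp add: \<delta>_def)
  have "\<exists>d\<in>D. dist d (b i) < \<delta>" for i
    using D \<delta> by (metis UNIV_I closure_approachable)
  then obtain d where d: "\<And>i. d i \<in> D" "\<And>i. dist (d i) (b i) < \<delta>" by metis
  show ?thesis
  proof (rule that[of "d ` K"])
    fix F assume F: "finite F" "cinner.orthonormal F" "d ` K \<subseteq> cspan F"
    define p where "p = cinner.proj F"
    define r where "r = (\<lambda>i. cinner (p (b i)) (a i) - cinner (b i) (a i))"
    have p_diff: "p (x - y) = p x - p y" for x y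
      by (simp add: p_def cinner.proj_def cinner.diff_left complex_vs.scale_left_diff_distrib sum_subtractf)
    have p_le: "norm (p x) \<le> norm x" for x
      unfolding p_def by (rule norm_cinner_proj_le[OF F(1,2)])
    have r_has_sum: "(r has_sum ((\<Sum>f\<in>F. cinner (A f) f) - tr)) I"
      using has_sum_add[OF has_sum_compression[OF F(1)], of "\<lambda>i. - cinner (b i) (a i)" "- tr"] has_sum_tr
      by (simp add: r_def p_def has_sum_uminus)
    have r_le: "norm (r i) \<le> 2 * c i" for i
    proof -
      have "norm (r i) \<le> norm (p (b i) - b i) * norm (a i)"
        unfolding r_def cinner.diff_left[symmetric] by (rule norm_cinner_le)
      also have "\<dots> \<le> (2 * norm (b i)) * norm (a i)"
        using p_le[of "b i"] norm_triangle_ineq4[of "p (b i)" "b i"] by (intro mult_right_mono) auto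
      finally show ?thesis by (simp add: c_def mult_ac)
    qed
    have r_le_K: "norm (r i) \<le> 2 * \<delta> * norm (a i)" if "i \<in> K" for i
    proof -
      \<comment> \<open>The projection fixes \<open>d i\<close>, so its error at \<open>b i\<close>
        is its error at the small vector \<open>b i - d i\<close>.\<close>
      have "p (d i) = d i" using F that unfolding p_def by (intro cinner_proj_span) auto
      then have eq: "p (b i) - b i = p (b i - d i) - (b i - d i)" by (simp add: p_diff)
      have "norm (p (b i) - b i) \<le> 2 * norm (b i - d i)"
        using p_le[of "b i - d i"] norm_triangle_ineq4[of "p (b i - d i)" "b i - d i"]
        unfolding eq by linarith
      also have "\<dots> \<le> 2 * \<delta>" using d(2)[of i] by (simp add: dist_norm norm_minus_commute)
      finally have "norm (p (b i) - b i) * norm (a i) \<le> 2 * \<delta> * norm (a i)"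
        by (rule mult_right_mono) simp
      moreover have "norm (r i) \<le> norm (p (b i) - b i) * norm (a i)"
        unfolding r_def cinner.diff_left[symmetric] by (rule norm_cinner_le)
      ultimately show ?thesis by simp
    qed
    have c_IK: "c summable_on (I - K)"
      using summable unfolding c_def by (rule summable_on_subset_banach) auto
    have "(r has_sum ((\<Sum>f\<in>F. cinner (A f) f) - tr - sum r K)) (I - K)"
      by (intro has_sum_Diff r_has_sum has_sum_finite K)
    then have "norm ((\<Sum>f\<in>F. cinner (A f) f) - tr - sum r K) \<le> (\<Sum>\<^sub>\<infinity>i\<in>I - K. 2 * c i)"
      by (rule norm_infsum_le[OF _ has_sum_infsum]) (use c_IK r_le in \<open>auto intro: summable_on_cmult_right\<close>)
    also have "\<dots> = 2 * infsum c (I - K)" using c_IK by (simp add: infsum_cmult_right)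
    finally have 1: "norm ((\<Sum>f\<in>F. cinner (A f) f) - tr - sum r K) \<le> 2 * infsum c (I - K)" .
    have "norm (sum r K) \<le> (\<Sum>i\<in>K. 2 * \<delta> * norm (a i))"
      using r_le_K by (rule sum_norm_le)
    also have "\<dots> \<le> 2 * \<delta> * M"
      using \<delta> unfolding M_def sum_distrib_left[symmetric] by (intro mult_left_mono) auto
    also have "\<dots> = \<epsilon> / 4" using M by (simp add: \<delta>_def)
    finally have "norm (sum r K) \<le> \<epsilon> / 4" .
    with 1 tail show "norm ((\<Sum>f\<in>F. cinner (A f) f) - tr) < \<epsilon>"
      using norm_triangle_ineq[of "(\<Sum>f\<in>F. cinner (A f) f) - tr - sum r K" "sum r K"] \<open>0 < \<epsilon>\<close>
      by simp
  qed (use K d in auto)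
qed

text \<open>With \<open>cspan E\<close> as the dense set, the finitely many vectors of
  \<open>F0\<close> lie in the span of a finite part of \<open>E\<close>, and every larger finite
  part of \<open>E\<close> is an admissible \<open>F\<close>.\<close>

lemma has_sum_orthonormal_basis:
  assumes E: "orthonormal_basis E"
  shows "((\<lambda>e. cinner (A e) e) has_sum tr) E"
proof (rule has_sum_distI)
  fix \<epsilon> :: real assume "0 < \<epsilon>"
  have "closure (cspan E) = UNIV" using E by (simp add: orthonormal_basis_def complete_system_def)
  then obtain F0 where F0: "finite F0" "F0 \<subseteq> cspan E"
    "\<And>F. \<lbrakk>finite F; cinner.orthonormal F; F0 \<subseteq> cspan F\<rbrakk> \<Longrightarrow> norm ((\<Sum>f\<in>F. cinner (A f) f) - tr) < \<epsilon>"
    by (rule compression_approx[OF _ \<open>0 < \<epsilon>\<close>]) blast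
  have "\<exists>X. finite X \<and> X \<subseteq> E \<and> v \<in> cspan X" if "v \<in> F0" for v
  proof -
    have "v \<in> cspan E" using F0(2) that by blast
    from span_finite_subset[OF this] show ?thesis by metis
  qed
  then obtain X where X: "\<And>v. v \<in> F0 \<Longrightarrow> finite (X v) \<and> X v \<subseteq> E \<and> v \<in> cspan (X v)" by metis
  have "norm ((\<Sum>f\<in>Y. cinner (A f) f) - tr) < \<epsilon>" if "finite Y" "\<Union>(X ` F0) \<subseteq> Y" "Y \<subseteq> E" for Y
  proof (rule F0(3))
    show "cinner.orthonormal Y"
      using cinner.orthonormal_subset[OF orthonormal_basis_orthonormal[OF E] that(3)] .
    show "F0 \<subseteq> cspan Y"
    proof
      fix v assume v: "v \<in> F0"
      have "X v \<subseteq> Y" using v that(2) by blast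
      from complex_vs.span_mono[OF this] X[OF v] show "v \<in> cspan Y" by blast
    qed
  qed fact
  then show "\<exists>X. finite X \<and> X \<subseteq> E \<and> (\<forall>Y. finite Y \<and> X \<subseteq> Y \<and> Y \<subseteq> E \<longrightarrow>
      dist (\<Sum>e\<in>Y. cinner (A e) e) tr < \<epsilon>)"
    using X F0(1) by (intro exI[of _ "\<Union>(X ` F0)"]) (auto simp: dist_norm)
qed

text \<open>The existence of a basis makes the description unique: without one, the condition
  defining \<open>op_trace\<close> would hold vacuously for every number.\<close>

lemma op_trace_eq:
  fixes E :: "'h set"
  assumes "orthonormal_basis E"
  shows "op_trace A = tr"
  unfolding op_trace_def
proof (rule the_equality)
  show "\<forall>E. orthonormal_basis E \<longrightarrow> ((\<lambda>e. cinner (A e) e) has_sum tr) E"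
    using has_sum_orthonormal_basis by blast
  show "t = tr" if "\<forall>E. orthonormal_basis E \<longrightarrow> ((\<lambda>e. cinner (A e) e) has_sum t) E" for t
    using has_sum_unique[OF _ has_sum_orthonormal_basis[OF assms]] that assms by blast
qed

end

section \<open>Nuclear representations of trace class operators\<close>

lemma bounded_operatorD:
  assumes "bounded_operator A"
  shows "A (x + y) = A x + A y" "A (c *\<^sub>C x) = c *\<^sub>C A x" "A (x - y) = A x - A y"
    "A (sum f F) = (\<Sum>i\<in>F. A (f i))"
proof -
  have "linear A" using assms bounded_linear.linear by (auto simp: bounded_operator_def)
  then show "A (x + y) = A x + A y" "A (x - y) = A x - A y" "A (sum f F) = (\<Sum>i\<in>F. A (f i))"
    by (simp_all add: linear_add linear_diff linear_sum)
  show "A (c *\<^sub>C x) = c *\<^sub>C A x" using assms by (simp add: bounded_operator_def)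
qed

text \<open>Polarization: the quadratic form is real, and the vanishing of its imaginary part at
  \<open>x + y\<close> and at \<open>x + \<i> *\<^sub>C y\<close> gives the imaginary and the real
  part of Hermitian symmetry.\<close>

lemma psd_form_operator:
  assumes P: "bounded_operator P"
    and pos: "\<And>u. Im (cinner (P u) u) = 0 \<and> 0 \<le> Re (cinner (P u) u)"
  shows "psd_form (\<lambda>x y. cinner (P x) y)"
proof
  note lin = bounded_operatorD[OF P]
  show "cinner (P x) y = cnj (cinner (P y) x)" for x y
  proof (rule complex_eqI)
    have "Im (cinner (P (x + y)) (x + y)) = Im (cinner (P x) y) + Im (cinner (P y) x)"
      using pos[of x] pos[of y] by (simp add: lin cinner_add_left cinner.add_right)
    then show "Im (cinner (P x) y) = Im (cnj (cinner (P y) x))" using pos[of "x + y"] by simp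
    have "Im (cinner (P (x + \<i> *\<^sub>C y)) (x + \<i> *\<^sub>C y)) = - Re (cinner (P x) y) + Re (cinner (P y) x)"
      using pos[of x] pos[of y]
      by (simp add: lin cinner_add_left cinner.add_right cinner_scaleC_left cinner.scale_right)
    then show "Re (cinner (P x) y) = Re (cnj (cinner (P y) x))" using pos[of "x + \<i> *\<^sub>C y"] by simp
  qed
qed (use pos bounded_operatorD[OF P] in \<open>simp_all add: cinner_add_left cinner_scaleC_left\<close>)

text \<open>Orthonormalising a dense sequence for the form \<open>(P x, y)\<close> of the modulus \<open>P\<close> of \<open>A\<close> gives vectors
  \<open>g\<close> with \<open>A u = \<Sum> (u, P g) A g\<close> and \<open>\<Sum> \<parallel>P g\<parallel> \<parallel>A g\<parallel> = \<Sum> \<parallel>P g\<parallel>\<^sup>2 = Tr P\<close>. No square root of \<open>P\<close> and no polar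
  decomposition is needed.\<close>

lemma trace_class_nuclear:
  fixes A :: "'h::complex_hilbert \<Rightarrow> 'h"
  assumes sep: "separable_space (euclidean :: 'h topology)" and "trace_class A"
  obtains I :: "'h set" and a b where "nuclear A I a b"
proof -
  obtain P E where A: "bounded_operator A" and mod: "is_modulus P A" and E: "orthonormal_basis E"
    and summ: "(\<lambda>e. Re (cinner (P e) e)) summable_on E"
    using assms(2) unfolding trace_class_def by blast
  have P: "bounded_operator P" and
    pos: "\<And>u. Im (cinner (P u) u) = 0 \<and> 0 \<le> Re (cinner (P u) u)" and
    PP: "\<And>u v. cinner (P (P u)) v = cinner (A u) (A v)"
    using mod unfolding is_modulus_def by blast+
  define h where "h = (\<lambda>x y. cinner (P x) y)"
  interpret h: psd_form h unfolding h_def by (rule psd_form_operator[OF P pos])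
  have h_right: "h x y = cinner x (P y)" for x y
    using h.commute[of x y] cinner_commute[of x "P y"] by (simp add: h_def)
  have norm_A: "norm (A u) = norm (P u)" for u
  proof -
    have "Re (cinner (A u) (A u)) = Re (cinner (P u) (P u))"
      using PP[of u u] h_right[of "P u" u] by (simp add: h_def)
    then show ?thesis by (simp add: Re_cinner_self)
  qed
  obtain C where C: "0 < C" "\<And>x. norm (P x) \<le> norm x * C"
    using P bounded_linear.pos_bounded unfolding bounded_operator_def by blast
  have h_le: "Re (h x x) \<le> C * (norm x)\<^sup>2" for x
  proof -
    have "Re (h x x) \<le> norm (h x x)" by (rule complex_Re_le_cmod)
    also have "\<dots> \<le> norm (P x) * norm x" unfolding h_def by (rule norm_cinner_le)
    also have "\<dots> \<le> (norm x * C) * norm x" by (intro mult_right_mono C) simp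
    finally show ?thesis by (simp add: power2_eq_square mult_ac)
  qed
  \<comment> \<open>Cauchy-Schwarz for \<open>h\<close> at \<open>x\<close> and \<open>P x\<close>,
    where \<open>h x (P x)\<close> is the squared norm of \<open>P x\<close>. Thus the seminorm of
    \<open>h\<close> controls \<open>P\<close>, and with it \<open>A\<close>.\<close>
  have norm_P: "(norm (P x))\<^sup>2 \<le> C * Re (h x x)" for x
  proof (cases "P x = 0")
    case False
    have "h x (P x) = complex_of_real ((norm (P x))\<^sup>2)" by (simp add: h_def cinner_self)
    then have "norm (h x (P x)) = (norm (P x))\<^sup>2" by (simp only: norm_of_real) simp
    then have "((norm (P x))\<^sup>2)\<^sup>2 \<le> Re (h x x) * Re (h (P x) (P x))"
      using h.Cauchy_Schwarz[of x "P x"] by simp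
    also have "\<dots> \<le> Re (h x x) * (C * (norm (P x))\<^sup>2)"
      by (intro mult_left_mono h_le h.nonneg)
    finally have "(norm (P x))\<^sup>2 * (norm (P x))\<^sup>2 \<le> (C * Re (h x x)) * (norm (P x))\<^sup>2"
      by (simp add: power2_eq_square mult_ac)
    then show ?thesis using False by (simp only: mult_le_cancel_right) simp
  qed (use C h.nonneg in simp)
  obtain S :: "'h set" where S: "countable S" "closure S = UNIV"
    using sep unfolding separable_space_def by auto
  define d where "d = from_nat_into S"
  have range_d: "range d = S"
    using S by (auto simp: d_def intro!: range_from_nat_into)
  \<comment> \<open>Step \<open>n\<close> absorbs the \<open>n\<close>-th vector of the dense
    sequence up to seminorm 0. The sets are nested, so their union stays orthonormal for
    \<open>h\<close>.\<close>
  obtain G where G: "\<And>n. finite (G n) \<and> h.orthonormal (G n)"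
    "\<And>n. G n \<subseteq> G (Suc n) \<and> (\<exists>y\<in>cspan (G (Suc n)). Re (h (d n - y) (d n - y)) = 0)"
  proof -
    have "\<exists>G. \<forall>n. (finite (G n) \<and> h.orthonormal (G n)) \<and>
        (G n \<subseteq> G (Suc n) \<and> (\<exists>y\<in>cspan (G (Suc n)). Re (h (d n - y) (d n - y)) = 0))"
    proof (rule dependent_nat_choice)
      show "\<exists>F. finite F \<and> h.orthonormal F" using h.orthonormal_empty by blast
      show "\<exists>F'. (finite F' \<and> h.orthonormal F') \<and>
          F \<subseteq> F' \<and> (\<exists>y\<in>cspan F'. Re (h (d n - y) (d n - y)) = 0)"
        if F: "finite F \<and> h.orthonormal F" for F n
      proof -
        obtain F' y where "finite F'" "h.orthonormal F'" "F \<subseteq> F'" "y \<in> cspan F'"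
          "Re (h (d n - y) (d n - y)) = 0"
          using h.Gram_Schmidt_step[OF conjunct1[OF F] conjunct2[OF F]] .
        then show ?thesis by blast
      qed
    qed
    then obtain G where G: "\<forall>n. (finite (G n) \<and> h.orthonormal (G n)) \<and>
        (G n \<subseteq> G (Suc n) \<and> (\<exists>y\<in>cspan (G (Suc n)). Re (h (d n - y) (d n - y)) = 0))" ..
    show ?thesis by (rule that[of G]) (use G in simp_all)
  qed
  have mono: "G m \<subseteq> G n" if "m \<le> n" for m n
    by (rule lift_Suc_mono_le[OF _ that]) (use G(2) in blast)
  define I where "I = (\<Union>n. G n)"
  have "h.orthonormal I"
    unfolding h.orthonormal_def
  proof (intro ballI)
    fix f g assume "f \<in> I" "g \<in> I"
    then obtain m n where "f \<in> G m" "g \<in> G n" by (auto simp: I_def)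
    then have "f \<in> G (max m n)" "g \<in> G (max m n)"
      using mono[of m "max m n"] mono[of n "max m n"] by auto
    then show "h f g = (if f = g then 1 else 0)"
      using G(1)[of "max m n"] by (auto simp: h.orthonormal_def)
  qed
  note on = h.orthonormal_subset[OF this]
  show ?thesis
  proof (rule that[of I P A], unfold_locales)
    \<comment> \<open>Parseval along \<open>E\<close> expands the norms of \<open>P g\<close>. For
      each \<open>e\<close>, Bessel's inequality for \<open>h\<close> bounds the sum over
      \<open>g\<close> by \<open>h e e\<close>, which is summable over \<open>E\<close>.\<close>
    have "(\<Sum>g\<in>K. (norm (P g))\<^sup>2) \<le> (\<Sum>\<^sub>\<infinity>e\<in>E. Re (h e e))" if K: "finite K" "K \<subseteq> I" for K
    proof (rule has_sum_mono)
      show "((\<lambda>e. \<Sum>g\<in>K. (norm (cinner (P g) e))\<^sup>2) has_sum (\<Sum>g\<in>K. (norm (P g))\<^sup>2)) E"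
        by (intro has_sum_finite_sum Parseval E)
      show "((\<lambda>e. Re (h e e)) has_sum (\<Sum>\<^sub>\<infinity>e\<in>E. Re (h e e))) E"
        using summ by (simp add: h_def)
      have "norm (cinner (P g) e) = norm (h e g)" for e g
        using h.commute[of e g] by (simp add: h_def)
      then show "(\<Sum>g\<in>K. (norm (cinner (P g) e))\<^sup>2) \<le> Re (h e e)" for e
        using h.Bessel[OF K(1) on[OF K(2)], of e] by simp
    qed
    then have "(\<lambda>g. (norm (P g))\<^sup>2) summable_on I"
      by (intro nonneg_bounded_partial_sums_imp_summable_on[where C = "\<Sum>\<^sub>\<infinity>e\<in>E. Re (h e e)"]
          eventually_finite_subsets_at_top_weakI) simp_all
    then show "(\<lambda>g. norm (P g) * norm (A g)) summable_on I"
      by (simp add: norm_A power2_eq_square)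
  next
    fix u
    show "((\<lambda>g. cinner u (P g) *\<^sub>C A g) has_sum A u) I"
    proof (rule has_sum_distI)
      fix \<epsilon> :: real assume "0 < \<epsilon>"
      \<comment> \<open>Minimality of the projection allows \<open>y\<close> as a competitor, and
        \<open>d n - y\<close> has seminorm 0; the squared error is then at most
        \<open>2 * (C * \<delta>)\<^sup>2\<close>, which is half of
        \<open>\<epsilon>\<^sup>2\<close>.\<close>
      define \<delta> where "\<delta> = \<epsilon> / (2 * C)"
      have \<delta>: "0 < \<delta>" using C \<open>0 < \<epsilon>\<close> by (simp add: \<delta>_def)
      have "u \<in> closure (range d)" using S(2) range_d by simp
      then obtain n where n: "dist (d n) u < \<delta>"
        using \<delta> unfolding closure_approachable by blast
      obtain y where y: "y \<in> cspan (G (Suc n))" "Re (h (d n - y) (d n - y)) = 0"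
        using G(2)[of n] by blast
      have "dist (\<Sum>g\<in>Y. cinner u (P g) *\<^sub>C A g) (A u) < \<epsilon>"
        if Y: "finite Y" "G (Suc n) \<subseteq> Y" "Y \<subseteq> I" for Y
      proof -
        have yY: "y \<in> cspan Y" using y(1) complex_vs.span_mono[OF Y(2)] by blast
        define x where "x = u - h.proj Y u"
        have "(\<Sum>g\<in>Y. cinner u (P g) *\<^sub>C A g) = A (h.proj Y u)"
          by (simp add: h.proj_def bounded_operatorD[OF A] h_right)
        then have "dist (\<Sum>g\<in>Y. cinner u (P g) *\<^sub>C A g) (A u) = norm (P x)"
          by (simp add: x_def dist_norm norm_minus_commute bounded_operatorD[OF A] flip: norm_A)
        also have "\<dots> < \<epsilon>"
        proof (rule power2_less_imp_less)
          have "(norm (P x))\<^sup>2 \<le> C * Re (h x x)" by (rule norm_P)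
          also have "\<dots> \<le> C * Re (h (u - y) (u - y))"
            unfolding x_def using C by (intro mult_left_mono h.proj_minimal Y on yY) auto
          also have "\<dots> \<le> C * (2 * Re (h (u - d n) (u - d n)))"
            using h.self_add_le[of "u - d n" "d n - y"] y(2) C by simp
          also have "\<dots> \<le> C * (2 * (C * (norm (u - d n))\<^sup>2))"
            using C h_le by simp
          also have "\<dots> = 2 * (C * norm (u - d n))\<^sup>2"
            by (simp add: power2_eq_square)
          also have "\<dots> \<le> 2 * (C * \<delta>)\<^sup>2"
            using n C by (intro mult_left_mono power_mono) (auto simp: dist_norm norm_minus_commute)
          also have "\<dots> < \<epsilon>\<^sup>2"
            using C \<open>0 < \<epsilon>\<close> by (simp add: \<delta>_def power2_eq_square)
          finally show "(norm (P x))\<^sup>2 < \<epsilon>\<^sup>2" .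
        qed (use \<open>0 < \<epsilon>\<close> in simp)
        finally show ?thesis .
      qed
      then show "\<exists>X. finite X \<and> X \<subseteq> I \<and> (\<forall>Y. finite Y \<and> X \<subseteq> Y \<and> Y \<subseteq> I \<longrightarrow>
          dist (\<Sum>g\<in>Y. cinner u (P g) *\<^sub>C A g) (A u) < \<epsilon>)"
        using G(1)[of "Suc n"] by (intro exI[of _ "G (Suc n)"]) (auto simp: I_def)
    qed
  qed
qed

lemma trace_class_approx:
  fixes A :: "'h::complex_hilbert \<Rightarrow> 'h"
  assumes "separable_space (euclidean :: 'h topology)" "trace_class A" "closure D = UNIV" "0 < \<epsilon>"
  obtains F0 where "finite F0" "F0 \<subseteq> D"
    "\<And>F. \<lbrakk>finite F; cinner.orthonormal F; F0 \<subseteq> cspan F\<rbrakk> \<Longrightarrow>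
      norm ((\<Sum>f\<in>F. cinner (A f) f) - op_trace A) < \<epsilon>"
proof -
  obtain I :: "'h set" and a b where "nuclear A I a b"
    using trace_class_nuclear[OF assms(1,2)] .
  then interpret nuclear A I a b .
  obtain E :: "'h set" where "orthonormal_basis E" using assms(2) unfolding trace_class_def by blast
  note tr = op_trace_eq[OF this]
  show ?thesis
    by (rule compression_approx[OF assms(3,4)]) (rule that, auto simp: tr)
qed

lemma trace_class_bound:
  fixes A :: "'h::complex_hilbert \<Rightarrow> 'h"
  assumes "separable_space (euclidean :: 'h topology)" "trace_class A"
  obtains C where "\<And>F. \<lbrakk>finite F; cinner.orthonormal F\<rbrakk> \<Longrightarrow> norm (\<Sum>f\<in>F. cinner (A f) f) \<le> C"
proof -
  obtain I :: "'h set" and a b where "nuclear A I a b"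
    using trace_class_nuclear[OF assms] .
  then interpret nuclear A I a b .
  from compression_bound that show ?thesis by blast
qed

section \<open>Triangular systems of generalized eigenvectors\<close>

text \<open>The recursion peels off the outermost factor; induction along the chain starting from a
  generalized eigenvector needs the innermost one.\<close>

lemma op_power_Suc_right: "op_power A (Suc n) = op_power A n \<circ>\<^sub>m A"
proof (induction n)
  case 0
  then show ?case by (auto simp: fun_eq_iff map_comp_def split: option.splits)
next
  case (Suc n)
  have "op_power A (Suc (Suc n)) = A \<circ>\<^sub>m (op_power A n \<circ>\<^sub>m A)" using Suc by simp
  also have "\<dots> = op_power A (Suc n) \<circ>\<^sub>m A" by (auto simp: fun_eq_iff map_comp_def split: option.splits)
  finally show ?case .
qed

section \<open>Finite independent sets and the extended dimension\<close>

lemma independent_card_le_cdim_ext: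
  assumes "finite C" "complex_vs.independent C" "C \<subseteq> V"
  shows "enat (card C) \<le> cdim_ext V"
proof (cases "\<exists>B. finite B \<and> V \<subseteq> cspan B")
  case True
  then obtain B0 where B0: "finite B0" "V \<subseteq> cspan B0" by blast
  obtain B where B: "B \<subseteq> V" "complex_vs.independent B" "V \<subseteq> cspan B" "card B = cdim V"
    using complex_vs.basis_exists by blast
  have "finite B" using complex_vs.independent_span_bound[OF B0(1) B(2)] B(1) B0(2) by blast
  then have "card C \<le> card B"
    using complex_vs.independent_span_bound[OF _ assms(2)] assms(3) B(3) by blast
  then show ?thesis using True B(4) by (simp add: cdim_ext_def)
next
  case False
  then show ?thesis unfolding cdim_ext_def by (subst if_not_P) auto
qed

text \<open>An infinite basis contains finite subsets of every size, so infinite dimension is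
  covered by letting the finite number \<open>k\<close> vary.\<close>

lemma independent_of_card_le_cdim_ext:
  assumes "enat k \<le> cdim_ext V"
  obtains C where "finite C" "complex_vs.independent C" "C \<subseteq> V" "card C = k"
proof -
  obtain B where B: "B \<subseteq> V" "complex_vs.independent B" "V \<subseteq> cspan B" "card B = cdim V"
    using complex_vs.basis_exists by blast
  have "\<exists>C\<subseteq>B. finite C \<and> card C = k"
  proof (cases "finite B")
    case True
    then have "k \<le> card B" using assms B by (auto simp: cdim_ext_def split: if_splits)
    then show ?thesis using True by (meson obtain_subset_with_card_n)
  next
    case False
    then show ?thesis using infinite_arbitrarily_large by blast
  qed
  then obtain C where C: "C \<subseteq> B" "finite C" "card C = k" by blast
  then show ?thesis using that[of C] B complex_vs.independent_mono by blast
qed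

section \<open>Generalized eigenspaces and triangular sets of a partially defined operator\<close>

locale hilbert_operator =
  fixes A :: "'h::complex_hilbert \<Rightarrow> 'h option"
  assumes linear_operator: "linear_operator A"
begin

abbreviation "ap \<equiv> op_apply A"
abbreviation "gen \<equiv> generalized_eigenspace A"
abbreviation "shift \<mu> \<equiv> op_lincomb 1 A (- \<mu>) Some"

lemma subspace_dom: "complex_vs.subspace (dom A)"
  using linear_operator unfolding linear_operator_def complex_vs.subspace_def by blast

lemma dom_closed: "0 \<in> dom A" "u \<in> dom A \<Longrightarrow> v \<in> dom A \<Longrightarrow> u + v \<in> dom A" "u \<in> dom A \<Longrightarrow> c *\<^sub>C u \<in> dom A"
    "u \<in> dom A \<Longrightarrow> v \<in> dom A \<Longrightarrow> u - v \<in> dom A"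
  using complex_vs.subspace_0 complex_vs.subspace_add complex_vs.subspace_scale complex_vs.subspace_diff
    subspace_dom by blast+

lemma ap_zero: "ap 0 = 0"
  using linear_operator by (simp add: linear_operator_def)

lemma ap_add: "u \<in> dom A \<Longrightarrow> v \<in> dom A \<Longrightarrow> ap (u + v) = ap u + ap v"
  using linear_operator unfolding linear_operator_def by (metis option.sel)

lemma ap_scale: "u \<in> dom A \<Longrightarrow> ap (c *\<^sub>C u) = c *\<^sub>C ap u"
  using linear_operator unfolding linear_operator_def by (metis option.sel)

lemma ap_diff: "u \<in> dom A \<Longrightarrow> v \<in> dom A \<Longrightarrow> ap (u - v) = ap u - ap v"
  using ap_add[of "u - v" v] dom_closed(4)[of u v] by simp

lemma shift_eq: "shift \<mu> u = (if u \<in> dom A then Some (ap u - \<mu> *\<^sub>C u) else None)"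
  by (auto simp: op_lincomb_def scaleC_one)

lemma op_power_shift_Suc:
  "op_power (shift \<mu>) (Suc n) v = Some 0 \<longleftrightarrow>
    v \<in> dom A \<and> op_power (shift \<mu>) n (ap v - \<mu> *\<^sub>C v) = Some 0"
  unfolding op_power_Suc_right map_comp_def shift_eq[of \<mu> v] by simp

lemma op_power_shift_mono:
  assumes "op_power (shift \<mu>) m v = Some 0" "m \<le> n"
  shows "op_power (shift \<mu>) n v = Some 0"
  using assms(2)
proof (induction n rule: dec_induct)
  case (step n)
  then show ?case
    using dom_closed(1) by (simp add: map_comp_def shift_eq ap_zero)
qed (rule assms(1))

lemma op_power_shift_add_scale:
  assumes "op_power (shift \<mu>) n x = Some 0" "op_power (shift \<mu>) n y = Some 0"
  shows "op_power (shift \<mu>) n (x + c *\<^sub>C y) = Some 0"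
  using assms
proof (induction n arbitrary: x y)
  case (Suc n)
  then have "x \<in> dom A" "y \<in> dom A"
    and "op_power (shift \<mu>) n ((ap x - \<mu> *\<^sub>C x) + c *\<^sub>C (ap y - \<mu> *\<^sub>C y)) = Some 0"
    unfolding op_power_shift_Suc by blast+
  moreover have "(ap x - \<mu> *\<^sub>C x) + c *\<^sub>C (ap y - \<mu> *\<^sub>C y) = ap (x + c *\<^sub>C y) - \<mu> *\<^sub>C (x + c *\<^sub>C y)"
    using calculation(1,2)
    by (simp add: ap_add ap_scale dom_closed complex_vs.scale_right_distrib
        complex_vs.scale_right_diff_distrib complex_vs.scale_left_commute)
  ultimately show ?case unfolding op_power_shift_Suc by (simp add: dom_closed)
qed simp

lemma gen_iff: "v \<in> gen \<mu> \<longleftrightarrow> (\<exists>n. op_power (shift \<mu>) n v = Some 0)"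
proof
  assume "\<exists>n. op_power (shift \<mu>) n v = Some 0"
  then obtain n where "op_power (shift \<mu>) (Suc n) v = Some 0"
    using op_power_shift_mono le_SucI order_refl by metis
  then show "v \<in> gen \<mu>"
    unfolding generalized_eigenspace_def op_kernel_def by (intro UN_I[of "Suc n"]) auto
qed (auto simp: generalized_eigenspace_def op_kernel_def)

lemma gen_add_scale:
  assumes "x \<in> gen \<mu>" "y \<in> gen \<mu>"
  shows "x + c *\<^sub>C y \<in> gen \<mu>"
proof -
  obtain m n where "op_power (shift \<mu>) m x = Some 0" "op_power (shift \<mu>) n y = Some 0"
    using assms unfolding gen_iff by blast
  then have "op_power (shift \<mu>) (max m n) x = Some 0" "op_power (shift \<mu>) (max m n) y = Some 0"
    using op_power_shift_mono max.cobounded1 max.cobounded2 by blast+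
  then show ?thesis unfolding gen_iff using op_power_shift_add_scale by blast
qed

text \<open>In the chain obtained from \<open>v\<close> by iterating \<open>A - \<mu>\<close>, the
  last nonzero vector is an eigenvector.\<close>

lemma gen_nonzero_eigenvalue:
  assumes "v \<in> gen \<mu>" "v \<noteq> 0"
  shows "\<mu> \<in> eigenvalues A"
proof -
  obtain n where "op_power (shift \<mu>) n v = Some 0" using assms(1) gen_iff by blast
  then show ?thesis using assms(2)
  proof (induction n arbitrary: v)
    case (Suc n)
    then have v: "v \<in> dom A" "op_power (shift \<mu>) n (ap v - \<mu> *\<^sub>C v) = Some 0"
      unfolding op_power_shift_Suc by blast+
    show ?case
    proof (cases "ap v - \<mu> *\<^sub>C v = 0")
      case True
      then have "A v = Some (\<mu> *\<^sub>C v)" using v(1) by auto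
      then show ?thesis using Suc.prems(2) unfolding eigenvalues_def by blast
    next
      case False
      then show ?thesis using Suc.IH v(2) by blast
    qed
  qed simp
qed

text \<open>A Schur triangular form built one vector at a time. The generalized eigenvector
  \<open>v\<close> extends the invariant span; its normalized residual, which may no longer be a
  generalized eigenvector, extends the orthonormal set. The value \<open>\<mu>\<close> becomes the
  new diagonal entry.\<close>

inductive triangular :: "'h set \<Rightarrow> bool" where
  empty: "triangular {}"
| insert: "\<lbrakk>triangular F; v \<in> gen \<mu>; v \<notin> cspan F; v \<in> dom A; ap v - \<mu> *\<^sub>C v \<in> cspan F\<rbrakk>
    \<Longrightarrow> triangular (insert (cinner.normalize (v - cinner.proj F v)) F)"

text \<open>On a triangular set this is both a diagonal entry of the matrix of \<open>A\<close>,
  hence an eigenvalue, and a point of the numerical range, where the subgradient hypotheses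
  apply.\<close>

definition diag :: "'h \<Rightarrow> complex" where
  "diag f = cinner (ap f) f"

text \<open>The vector \<open>e\<close> is a multiple of \<open>v\<close> minus an element of the
  invariant span, so \<open>A - \<mu>\<close> maps it into \<open>cspan F\<close>. Since
  \<open>e\<close> is orthogonal to \<open>cspan F\<close>, its diagonal entry is
  \<open>\<mu>\<close>.\<close>

lemma triangular_step:
  assumes F: "finite F" "cinner.orthonormal F" "cspan F \<subseteq> dom A" "\<forall>x\<in>cspan F. ap x \<in> cspan F"
    and v: "v \<notin> cspan F" "v \<in> dom A" "ap v - \<mu> *\<^sub>C v \<in> cspan F"
  defines "e \<equiv> cinner.normalize (v - cinner.proj F v)"
  shows "e \<notin> F" "cinner.orthonormal (insert e F)" "e \<in> dom A" "ap e - \<mu> *\<^sub>C e \<in> cspan F"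
    "v \<in> cspan (insert e F)" "diag e = \<mu>"
    "\<And>x. x \<in> cspan F \<Longrightarrow> cinner x e = 0"
proof -
  define p where "p = cinner.proj F v"
  have p: "p \<in> cspan F" unfolding p_def by (rule cinner.proj_in_span)
  have "v - p \<noteq> 0" using p v(1) by auto
  then have r: "Re (cinner (v - p) (v - p)) \<noteq> 0" by (simp add: cinner_self)
  show "e \<notin> F" and on: "cinner.orthonormal (insert e F)"
    using cinner.orthonormal_insert_normalize[OF F(1,2) r[unfolded p_def]] by (simp_all add: e_def)
  define c where "c = complex_of_real (1 / sqrt (Re (cinner (v - p) (v - p))))"
  have c: "c \<noteq> 0" using r by (simp add: c_def cinner_self)
  have e: "e = c *\<^sub>C (v - p)" by (simp add: e_def cinner.normalize_def c_def p_def)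
  have pd: "p \<in> dom A" using p F(3) by blast
  then show ed: "e \<in> dom A" using v(2) by (simp add: e dom_closed)
  have "ap e - \<mu> *\<^sub>C e = c *\<^sub>C ((ap v - \<mu> *\<^sub>C v) - (ap p - \<mu> *\<^sub>C p))"
    using pd v(2) by (simp add: e ap_scale ap_diff dom_closed complex_vs.scale_right_diff_distrib
        complex_vs.scale_left_commute[of \<mu> c] algebra_simps)
  also have "\<dots> \<in> cspan F"
    by (intro complex_vs.span_scale complex_vs.span_diff p v(3) F(4)[rule_format])
  finally show tri: "ap e - \<mu> *\<^sub>C e \<in> cspan F" .
  have "v = inverse c *\<^sub>C e + p"
    using c by (simp add: e scaleC_scaleC scaleC_one)
  also have "\<dots> \<in> cspan (insert e F)"
    using p complex_vs.span_mono[of F "insert e F", OF subset_insertI]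
    by (intro complex_vs.span_add complex_vs.span_scale complex_vs.span_base[of e]) auto
  finally show "v \<in> cspan (insert e F)" .
  have "cinner e f = 0" if "f \<in> F" for f
    using on that \<open>e \<notin> F\<close> unfolding cinner.orthonormal_def by (metis insertCI)
  then have orth: "cinner e x = 0" if "x \<in> cspan F" for x
    using cinner.orthogonal_span that by blast
  then show orth': "cinner x e = 0" if "x \<in> cspan F" for x
    using that cinner.commute[of x e] by simp
  have ee: "cinner e e = 1" using on unfolding cinner.orthonormal_def by simp
  have "cinner (ap e - \<mu> *\<^sub>C e) e = 0" by (rule orth'[OF tri])
  then show "diag e = \<mu>" by (simp add: diag_def cinner.diff_left cinner.scale_left ee)
qed

lemma span_insert_invariant:
  assumes "cspan F \<subseteq> dom A" "\<forall>x\<in>cspan F. ap x \<in> cspan F"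
    and e: "e \<in> dom A" "ap e - \<mu> *\<^sub>C e \<in> cspan F"
    and x: "x \<in> cspan (insert e F)"
  shows "x \<in> dom A" "ap x \<in> cspan (insert e F)"
proof -
  obtain k where k: "x - k *\<^sub>C e \<in> cspan F" using x unfolding complex_vs.span_breakdown_eq by blast
  have "x = (x - k *\<^sub>C e) + k *\<^sub>C e" by simp
  then show "x \<in> dom A" using k assms(1) e(1) dom_closed by (metis subsetD)
  have "ap x = ap (x - k *\<^sub>C e) + (k *\<^sub>C (ap e - \<mu> *\<^sub>C e) + (k * \<mu>) *\<^sub>C e)"
    using \<open>x \<in> dom A\<close> e(1)
    by (simp add: ap_diff ap_scale dom_closed complex_vs.scale_right_diff_distrib scaleC_scaleC)
  also have "\<dots> \<in> cspan (insert e F)"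
    using assms(2)[rule_format, OF k] e(2) complex_vs.span_mono[of F "insert e F", OF subset_insertI]
    by (intro complex_vs.span_add complex_vs.span_scale complex_vs.span_base[of e]) auto
  finally show "ap x \<in> cspan (insert e F)" .
qed

lemma triangular_invariant:
  assumes "triangular F"
  shows "finite F \<and> cinner.orthonormal F \<and> cspan F \<subseteq> dom A \<and> (\<forall>x\<in>cspan F. ap x \<in> cspan F)"
  using assms
proof induction
  case empty
  then show ?case using dom_closed(1) by (simp add: ap_zero)
next
  case (insert F v \<mu>)
  then have F: "finite F" "cinner.orthonormal F" "cspan F \<subseteq> dom A" "\<forall>x\<in>cspan F. ap x \<in> cspan F"
    by blast+
  note st = triangular_step[OF F insert.hyps(3-5)]
  show ?case using F(1) st(2) span_insert_invariant[OF F(3,4) st(3,4)] by blast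
qed

lemmas triangularD = triangular_invariant[THEN conjunct1]
  triangular_invariant[THEN conjunct2, THEN conjunct1]
  triangular_invariant[THEN conjunct2, THEN conjunct2, THEN conjunct1]
  triangular_invariant[THEN conjunct2, THEN conjunct2, THEN conjunct2]

section \<open>Diagonal entries and algebraic multiplicities\<close>

definition count :: "'h set \<Rightarrow> complex \<Rightarrow> nat" where
  "count F \<nu> = card {f \<in> F. diag f = \<nu>}"

lemma count_insert:
  assumes "finite F" "e \<notin> F"
  shows "count (insert e F) \<nu> = (if diag e = \<nu> then Suc (count F \<nu>) else count F \<nu>)"
proof -
  have "{f \<in> insert e F. diag f = \<nu>} = (if diag e = \<nu> then insert e {f \<in> F. diag f = \<nu>} else {f \<in> F. diag f = \<nu>})"
    by auto
  then show ?thesis using assms by (simp add: count_def)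
qed

lemma count_mono: "F \<subseteq> F' \<Longrightarrow> finite F' \<Longrightarrow> count F \<nu> \<le> count F' \<nu>"
  unfolding count_def by (rule card_mono) auto

text \<open>The vectors \<open>v\<close> added for the value \<open>\<nu>\<close> each lie outside
  the span of what came before, hence are independent. So \<open>count F \<nu>\<close> is at most
  the dimension of \<open>gen \<nu> \<inter> cspan F\<close>.\<close>

lemma triangular_independent:
  assumes "triangular F"
  shows "\<exists>C. finite C \<and> complex_vs.independent C \<and> C \<subseteq> gen \<nu> \<inter> cspan F \<and> card C = count F \<nu>"
  using assms
proof induction
  case empty
  then show ?case by (intro exI[of _ "{}"]) (simp add: count_def complex_vs.independent_empty)
next
  case (insert F v \<mu>)
  note F = triangularD[OF insert.hyps(1)]
  define e where "e = cinner.normalize (v - cinner.proj F v)"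
  note st = triangular_step[OF F insert.hyps(3-5), folded e_def]
  obtain C where C: "finite C" "complex_vs.independent C" "C \<subseteq> gen \<nu> \<inter> cspan F" "card C = count F \<nu>"
    using insert.IH by blast
  have sub: "C \<subseteq> cspan (insert e F)"
    using C(3) complex_vs.span_mono[of F "insert e F", OF subset_insertI] by blast
  note cnt = count_insert[OF F(1) st(1), of \<nu>]
  have "\<exists>C. finite C \<and> complex_vs.independent C \<and> C \<subseteq> gen \<nu> \<inter> cspan (insert e F) \<and>
    card C = count (insert e F) \<nu>"
  proof (cases "\<nu> = \<mu>")
    case True
    have "cspan C \<subseteq> cspan F" using C(3) by (metis Int_subset_iff complex_vs.span_minimal complex_vs.subspace_span)
    then have "v \<notin> cspan C" using insert.hyps(3) by blast
    then have "v \<notin> C" "complex_vs.independent (insert v C)"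
      using complex_vs.span_base C(2) complex_vs.independent_insertI by blast+
    then show ?thesis
      using C sub True insert.hyps(2) st(5,6) cnt by (intro exI[of _ "insert v C"]) auto
  next
    case False
    then show ?thesis using C sub cnt st(6) by (intro exI[of _ C]) auto
  qed
  then show ?case unfolding e_def .
qed

text \<open>The reverse bound for the same dimension. Adding \<open>e\<close> with diagonal entry
  \<open>\<mu> \<noteq> \<nu>\<close> adds nothing to the generalized eigenspace:
  \<open>A - \<nu>\<close> multiplies the \<open>e\<close>-coordinate by
  \<open>\<mu> - \<nu>\<close>, so a vector annihilated by some power has coordinate 0. If
  \<open>\<mu> = \<nu>\<close>, the dimension grows by at most one.\<close>

lemma triangular_spanning:
  assumes "triangular F"
  shows "\<exists>C. finite C \<and> card C \<le> count F \<nu> \<and> gen \<nu> \<inter> cspan F \<subseteq> cspan C"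
  using assms
proof induction
  case empty
  then show ?case by (intro exI[of _ "{}"]) simp
next
  case (insert F v \<mu>)
  note F = triangularD[OF insert.hyps(1)]
  define e where "e = cinner.normalize (v - cinner.proj F v)"
  note st = triangular_step[OF F insert.hyps(3-5), folded e_def]
  have ee: "cinner e e = 1" using st(2) unfolding cinner.orthonormal_def by simp
  have coeff: "x - cinner x e *\<^sub>C e \<in> cspan F" if "x \<in> cspan (insert e F)" for x
  proof -
    obtain k where k: "x - k *\<^sub>C e \<in> cspan F" using \<open>x \<in> _\<close> unfolding complex_vs.span_breakdown_eq by blast
    have "cinner x e = k" using st(7)[OF k] by (simp add: cinner.diff_left cinner.scale_left ee)
    then show ?thesis using k by simp
  qed
  have coeff0: "x \<in> cspan F" if "x \<in> cspan (insert e F)" "cinner x e = 0" for x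
    using coeff[OF that(1)] that(2) by simp
  obtain C where C: "finite C" "card C \<le> count F \<nu>" "gen \<nu> \<inter> cspan F \<subseteq> cspan C"
    using insert.IH by blast
  note cnt = count_insert[OF F(1) st(1), of \<nu>]
  have "\<exists>C. finite C \<and> card C \<le> count (insert e F) \<nu> \<and> gen \<nu> \<inter> cspan (insert e F) \<subseteq> cspan C"
  proof (cases "\<nu> = \<mu>")
    case False
    have "cinner x e = 0" if "op_power (shift \<nu>) n x = Some 0" "x \<in> cspan (insert e F)" for n x
      using that
    proof (induction n arbitrary: x)
      case (Suc n)
      note inv = span_insert_invariant[OF F(3,4) st(3,4) Suc.prems(2)]
      define y where "y = ap x - \<nu> *\<^sub>C x"
      have "y \<in> cspan (insert e F)"
        unfolding y_def by (intro complex_vs.span_diff complex_vs.span_scale inv Suc.prems(2))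
      then have y0: "cinner y e = 0"
        using Suc unfolding op_power_shift_Suc y_def by blast
      define k where "k = cinner x e"
      define x' where "x' = x - k *\<^sub>C e"
      have x': "x' \<in> cspan F" using coeff[OF Suc.prems(2)] by (simp add: x'_def k_def)
      then have "x' \<in> dom A" using F(3) by blast
      then have "ap x = ap x' + k *\<^sub>C ap e"
        using ap_add[of x' "k *\<^sub>C e"] st(3) by (simp add: x'_def ap_scale dom_closed)
      moreover have "cinner (ap x') e = 0" by (intro st(7) F(4)[rule_format] x')
      ultimately have "cinner y e = k * (\<mu> - \<nu>)"
        using st(6) by (simp add: y_def cinner.diff_left cinner.scale_left cinner.add_left k_def
            diag_def algebra_simps)
      then show ?case using y0 False by (simp add: k_def)
    qed simp
    then have "gen \<nu> \<inter> cspan (insert e F) \<subseteq> gen \<nu> \<inter> cspan F"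
      using coeff0 gen_iff by blast
    then show ?thesis using C False cnt st(6) by (intro exI[of _ C]) auto
  next
    case True
    show ?thesis
    proof (cases "gen \<nu> \<inter> cspan (insert e F) \<subseteq> cspan F")
      case sub: True
      then show ?thesis using C True cnt st(6) by (intro exI[of _ C]) auto
    next
      case False
      then obtain x0 where x0: "x0 \<in> gen \<nu>" "x0 \<in> cspan (insert e F)" "x0 \<notin> cspan F" by blast
      then have nz: "cinner x0 e \<noteq> 0" using coeff0 by blast
      have "x \<in> cspan (insert x0 C)" if x: "x \<in> gen \<nu>" "x \<in> cspan (insert e F)" for x
      proof -
        \<comment> \<open>This multiple of \<open>x0\<close> cancels the \<open>e\<close>-coordinate
          of \<open>x\<close>.\<close>
        define k where "k = cinner x e / cinner x0 e"
        have "x + (- k) *\<^sub>C x0 \<in> gen \<nu>" using gen_add_scale x x0 by blast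
        then have "x - k *\<^sub>C x0 \<in> gen \<nu>" by simp
        moreover have "x - k *\<^sub>C x0 \<in> cspan F"
          using x x0 nz by (intro coeff0 complex_vs.span_diff complex_vs.span_scale)
            (simp_all add: k_def cinner.diff_left cinner.scale_left)
        ultimately have "x - k *\<^sub>C x0 \<in> cspan C" using C(3) by blast
        then show ?thesis unfolding complex_vs.span_breakdown_eq by blast
      qed
      moreover have "card (insert x0 C) \<le> Suc (card C)" by (rule card_insert_le_m1) simp_all
      ultimately show ?thesis
        using C True cnt st(6) by (intro exI[of _ "insert x0 C"]) auto
    qed
  qed
  then show ?case unfolding e_def .
qed

text \<open>Induction on the exponent: first \<open>ap v - \<mu> *\<^sub>C v\<close> is absorbed,
  after which \<open>v\<close> itself may be added. Every step uses the same \<open>\<mu>\<close>,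
  so the diagonal receives no other value.\<close>

lemma triangular_extend:
  assumes "triangular F" "v \<in> gen \<mu>"
  obtains F' where "triangular F'" "F \<subseteq> F'" "v \<in> cspan F'" "\<And>f. f \<in> F' - F \<Longrightarrow> diag f = \<mu>"
proof -
  obtain n where "op_power (shift \<mu>) n v = Some 0" using assms(2) gen_iff by blast
  then have "\<exists>F'. triangular F' \<and> F \<subseteq> F' \<and> v \<in> cspan F' \<and> (\<forall>f\<in>F' - F. diag f = \<mu>)"
    using assms(2)
  proof (induction n arbitrary: v)
    case 0
    then show ?case using assms(1) complex_vs.span_zero by (intro exI[of _ F]) simp
  next
    case (Suc n)
    then have v: "v \<in> dom A" "op_power (shift \<mu>) n (ap v - \<mu> *\<^sub>C v) = Some 0"
      unfolding op_power_shift_Suc by blast+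
    moreover from v(2) have "ap v - \<mu> *\<^sub>C v \<in> gen \<mu>" using gen_iff by blast
    ultimately obtain F1 where F1: "triangular F1" "F \<subseteq> F1" "ap v - \<mu> *\<^sub>C v \<in> cspan F1"
      "\<forall>f\<in>F1 - F. diag f = \<mu>"
      using Suc.IH by blast
    show ?case
    proof (cases "v \<in> cspan F1")
      case True
      then show ?thesis using F1 by blast
    next
      case False
      note st = triangular_step[OF triangularD[OF F1(1)] False v(1) F1(3)]
      show ?thesis
        using triangular.insert[OF F1(1) Suc.prems(2) False v(1) F1(3)] F1(2,4) st(5,6) by blast
    qed
  qed
  then show ?thesis using that by blast
qed

lemma triangular_extend_finite:
  assumes "triangular F" "finite V" "V \<subseteq> (\<Union>\<mu>\<in>M. gen \<mu>)"
  obtains F' where "triangular F'" "F \<subseteq> F'" "V \<subseteq> cspan F'" "\<And>f. f \<in> F' - F \<Longrightarrow> diag f \<in> M"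
proof -
  have "\<exists>F'. triangular F' \<and> F \<subseteq> F' \<and> V \<subseteq> cspan F' \<and> (\<forall>f\<in>F' - F. diag f \<in> M)"
    using assms(2,3)
  proof (induction V rule: finite_induct)
    case empty
    then show ?case using assms(1) by blast
  next
    case (insert v V)
    then obtain F1 where F1: "triangular F1" "F \<subseteq> F1" "V \<subseteq> cspan F1" "\<forall>f\<in>F1 - F. diag f \<in> M"
      by auto
    obtain \<mu> where \<mu>: "\<mu> \<in> M" "v \<in> gen \<mu>" using insert.prems by blast
    obtain F2 where F2: "triangular F2" "F1 \<subseteq> F2" "v \<in> cspan F2" "\<And>f. f \<in> F2 - F1 \<Longrightarrow> diag f = \<mu>"
      by (rule triangular_extend[OF F1(1) \<mu>(2)]) blast
    have "V \<subseteq> cspan F2" using F1(3) complex_vs.span_mono[OF F2(2)] by blast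
    moreover have "\<forall>f\<in>F2 - F. diag f \<in> M" using F1(4) F2(4) \<mu>(1) by blast
    ultimately show ?case using F1(2) F2(1-3) by blast
  qed
  then show ?thesis using that by blast
qed

text \<open>A value that occurs on the diagonal has a nonzero generalized eigenvector in the span,
  by the independent set of size \<open>count\<close>.\<close>

lemma triangular_diag_eigenvalue:
  assumes "triangular F" "f \<in> F"
  shows "diag f \<in> eigenvalues A"
proof -
  obtain C where C: "finite C" "complex_vs.independent C" "C \<subseteq> gen (diag f) \<inter> cspan F"
    "card C = count F (diag f)"
    using triangular_independent[OF assms(1)] by blast
  have "count F (diag f) \<noteq> 0"
    using assms triangularD(1)[OF assms(1)] by (auto simp: count_def)
  then obtain x where "x \<in> C" using C(4) by fastforce
  then have "x \<noteq> 0" using C(2) complex_vs.dependent_zero by blast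
  then show ?thesis using gen_nonzero_eigenvalue \<open>x \<in> C\<close> C(3) by blast
qed

lemma count_le_multiplicity:
  assumes "triangular F"
  shows "enat (count F \<nu>) \<le> algebraic_multiplicity A \<nu>"
  using triangular_independent[OF assms, of \<nu>] independent_card_le_cdim_ext
  unfolding algebraic_multiplicity_def by (metis le_inf_iff)

text \<open>Once \<open>k \<mu>\<close> independent vectors of \<open>gen \<mu>\<close> lie in the
  span, the spanning bound forces \<open>\<mu>\<close> to occur at least \<open>k \<mu>\<close>
  times on the diagonal.\<close>

lemma triangular_attains_multiplicity:
  assumes "triangular F" "finite M" "\<And>\<mu>. \<mu> \<in> M \<Longrightarrow> enat (k \<mu>) \<le> algebraic_multiplicity A \<mu>"
  obtains F' where "triangular F'" "F \<subseteq> F'" "\<And>f. f \<in> F' - F \<Longrightarrow> diag f \<in> M"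
    "\<And>\<mu>. \<mu> \<in> M \<Longrightarrow> k \<mu> \<le> count F' \<mu>"
proof -
  have "\<exists>C. finite C \<and> complex_vs.independent C \<and> C \<subseteq> gen \<mu> \<and> card C = k \<mu>" if "\<mu> \<in> M" for \<mu>
    using independent_of_card_le_cdim_ext[OF assms(3)[OF that, unfolded algebraic_multiplicity_def]] by metis
  then obtain C where C: "\<And>\<mu>. \<mu> \<in> M \<Longrightarrow>
      finite (C \<mu>) \<and> complex_vs.independent (C \<mu>) \<and> C \<mu> \<subseteq> gen \<mu> \<and> card (C \<mu>) = k \<mu>"
    by metis
  have fin: "finite (\<Union>\<mu>\<in>M. C \<mu>)" and sub: "(\<Union>\<mu>\<in>M. C \<mu>) \<subseteq> (\<Union>\<mu>\<in>M. gen \<mu>)"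
    using C assms(2) by blast+
  obtain F' where F': "triangular F'" "F \<subseteq> F'" "(\<Union>\<mu>\<in>M. C \<mu>) \<subseteq> cspan F'"
    "\<And>f. f \<in> F' - F \<Longrightarrow> diag f \<in> M"
    by (rule triangular_extend_finite[OF assms(1) fin sub]) blast
  have "k \<mu> \<le> count F' \<mu>" if \<mu>: "\<mu> \<in> M" for \<mu>
  proof -
    obtain D where D: "finite D" "card D \<le> count F' \<mu>" "gen \<mu> \<inter> cspan F' \<subseteq> cspan D"
      using triangular_spanning[OF F'(1)] by blast
    have "C \<mu> \<subseteq> cspan D" using C[OF \<mu>] F'(3) D(3) \<mu> by blast
    then have "card (C \<mu>) \<le> card D"
      using complex_vs.independent_span_bound[OF D(1)] C[OF \<mu>] by blast
    then show ?thesis using D(2) C[OF \<mu>] by simp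
  qed
  then show ?thesis using that F' by blast
qed

end

section \<open>Convex functions of the diagonal\<close>

lemma has_sum_ereal:
  assumes "(f has_sum s) A"
  shows "((\<lambda>x. ereal (f x)) has_sum ereal s) A"
proof -
  have "sum (\<lambda>x. ereal (f x)) = (\<lambda>F. ereal (sum f F))" by (simp add: fun_eq_iff)
  then show ?thesis using assms unfolding has_sum_def by (simp only: tendsto_ereal)
qed

context hilbert_operator
begin

lemma sum_diag_eq_sum_count:
  fixes p :: "complex \<Rightarrow> real"
  assumes "finite F" "finite M" "diag ` F \<subseteq> M"
  shows "(\<Sum>f\<in>F. p (diag f)) = (\<Sum>\<mu>\<in>M. real (count F \<mu>) * p \<mu>)"
proof -
  have "(\<Sum>f\<in>F. p (diag f)) = (\<Sum>\<mu>\<in>M. \<Sum>f\<in>{f \<in> F. diag f = \<mu>}. p (diag f))"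
    using sum.group[OF assms] by (rule sym)
  also have "\<dots> = (\<Sum>\<mu>\<in>M. real (count F \<mu>) * p \<mu>)"
    by (intro sum.cong) (simp_all add: count_def)
  finally show ?thesis .
qed

text \<open>Absorbing an eigenvector into the empty set puts only \<open>\<mu>\<close> on the
  diagonal. In this way bounds on diagonal entries reach every eigenvalue.\<close>

lemma eigenvalue_in_diag:
  assumes "\<mu> \<in> eigenvalues A"
  obtains F f where "triangular F" "f \<in> F" "diag f = \<mu>"
proof -
  obtain v where v: "v \<noteq> 0" "A v = Some (\<mu> *\<^sub>C v)" using assms unfolding eigenvalues_def by blast
  have "op_power (shift \<mu>) (Suc 0) v = Some 0" unfolding op_power_shift_Suc using v(2) by auto
  then have "v \<in> gen \<mu>" unfolding gen_iff by blast
  then obtain F where F: "triangular F" "v \<in> cspan F" "\<And>f. f \<in> F - {} \<Longrightarrow> diag f = \<mu>"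
    using triangular_extend[OF triangular.empty] by blast
  then have "F \<noteq> {}" using v(1) by auto
  then show ?thesis using F that by blast
qed

text \<open>The spectral part of the argument. Convexity and the quantization are condensed in
  \<open>form\<close>; the function \<open>s\<close> stands for the real form of
  \<open>Q(\<phi>(\<sigma>))\<close> plus the \<open>T\<close> term, and \<open>t\<close> for its
  trace.\<close>

lemma trace_inequality:
  fixes \<phi> :: "complex \<Rightarrow> ereal" and s :: "'h \<Rightarrow> real"
  assumes form: "\<And>u. \<lbrakk>u \<in> dom A; norm u = 1\<rbrakk> \<Longrightarrow>
      \<phi> (cinner (ap u) u) \<noteq> -\<infinity> \<and> \<phi> (cinner (ap u) u) \<le> ereal (s u)"
    and bound: "\<And>F. \<lbrakk>finite F; cinner.orthonormal F\<rbrakk> \<Longrightarrow> sum s F \<le> C"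
    and approx: "\<And>D \<epsilon>. \<lbrakk>closure D = UNIV; 0 < \<epsilon>\<rbrakk> \<Longrightarrow> \<exists>F0. finite F0 \<and> F0 \<subseteq> D \<and>
      (\<forall>F. finite F \<longrightarrow> cinner.orthonormal F \<longrightarrow> F0 \<subseteq> cspan F \<longrightarrow> sum s F \<le> t + \<epsilon>)"
    and c: "((\<forall>z. 0 \<le> \<phi> z) \<and> (\<forall>u. 0 \<le> s u)) \<or> complete_system (generalized_eigenvectors A)"
  shows "countable (positive_part A \<phi>)" (is "countable ?Pos")
    and "\<forall>\<mu>\<in>positive_part A \<phi>. algebraic_multiplicity A \<mu> \<noteq> \<infinity>"
    and "eigenvalue_sum A \<phi> (positive_part A \<phi>) < \<infinity>"
    and "eigenvalue_sum A \<phi> (positive_part A \<phi>) + eigenvalue_sum A \<phi> (negative_part A \<phi>) \<le> ereal t"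
proof -
  \<comment> \<open>Infinite values become 0 under \<open>real_of_ereal\<close>, so \<open>p\<close>
    represents \<open>\<phi>\<close> only where finiteness is known; below this is shown at the
    eigenvalues.\<close>
  define p where "p = (\<lambda>z. real_of_ereal (\<phi> z))"
  let ?m = "algebraic_multiplicity A"
  have diag: "\<phi> (diag f) = ereal (p (diag f)) \<and> p (diag f) \<le> s f" if "triangular F" "f \<in> F" for F f
  proof -
    have "f \<in> dom A" using triangularD(3)[OF that(1)] complex_vs.span_base[OF that(2)] by blast
    moreover have "norm f = 1" by (rule cinner_orthonormal_norm[OF triangularD(2)[OF that(1)] that(2)])
    ultimately have "\<phi> (diag f) \<noteq> -\<infinity>" "\<phi> (diag f) \<le> ereal (s f)"
      using form unfolding diag_def by blast+
    then show ?thesis by (cases "\<phi> (diag f)") (auto simp: p_def)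
  qed
  have sum_diag: "(\<Sum>f\<in>F. p (diag f)) \<le> sum s F" if "triangular F" for F
    using diag[OF that] by (intro sum_mono) blast
  have \<phi>_p: "\<phi> \<mu> = ereal (p \<mu>)" and m_pos: "1 \<le> ?m \<mu>" if \<mu>: "\<mu> \<in> eigenvalues A" for \<mu>
  proof -
    obtain F f where F: "triangular F" "f \<in> F" "diag f = \<mu>" using eigenvalue_in_diag[OF \<mu>] .
    then show "\<phi> \<mu> = ereal (p \<mu>)" using diag by blast
    have "card {f} \<le> count F \<mu>"
      unfolding count_def using F triangularD(1)[OF F(1)] by (intro card_mono) auto
    then have "1 \<le> enat (count F \<mu>)" by (simp add: one_enat_def)
    also have "\<dots> \<le> ?m \<mu>" by (rule count_le_multiplicity[OF F(1)])
    finally show "1 \<le> ?m \<mu>" .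
  qed
  have pos: "\<mu> \<in> eigenvalues A" "0 < p \<mu>" if "\<mu> \<in> ?Pos" for \<mu>
    using that \<phi>_p[of \<mu>] by (auto simp: positive_part_def)
  have neg: "\<mu> \<in> eigenvalues A" "p \<mu> < 0" if "\<mu> \<in> negative_part A \<phi>" for \<mu>
    using that \<phi>_p[of \<mu>] by (auto simp: negative_part_def)
  \<comment> \<open>The set \<open>F\<close> realizes the weights \<open>k\<close> and has all its
    diagonal entries in \<open>K\<close>, where \<open>p\<close> is positive; occurrences in excess
    of \<open>k\<close> only increase the sum.\<close>
  have bound_pos: "(\<Sum>\<mu>\<in>K. real (k \<mu>) * p \<mu>) \<le> C"
    if K: "finite K" "K \<subseteq> ?Pos" "\<And>\<mu>. \<mu> \<in> K \<Longrightarrow> enat (k \<mu>) \<le> ?m \<mu>" for K k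
  proof -
    obtain F where F: "triangular F" "\<And>f. f \<in> F - {} \<Longrightarrow> diag f \<in> K" "\<And>\<mu>. \<mu> \<in> K \<Longrightarrow> k \<mu> \<le> count F \<mu>"
      by (rule triangular_attains_multiplicity[OF triangular.empty K(1,3)]) blast+
    have "(\<Sum>\<mu>\<in>K. real (k \<mu>) * p \<mu>) \<le> (\<Sum>\<mu>\<in>K. real (count F \<mu>) * p \<mu>)"
      using F(3) pos(2) K(2) by (intro sum_mono mult_right_mono) (auto intro: less_imp_le)
    also have "\<dots> = (\<Sum>f\<in>F. p (diag f))"
      using F(2) by (intro sum_diag_eq_sum_count[symmetric] K triangularD[OF F(1)]) auto
    also have "\<dots> \<le> sum s F" by (rule sum_diag[OF F(1)])
    also have "\<dots> \<le> C" by (intro bound triangularD[OF F(1)])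
    finally show ?thesis .
  qed
  have fin: "?m \<mu> \<noteq> \<infinity>" if \<mu>: "\<mu> \<in> ?Pos" for \<mu>
  proof
    assume inf: "?m \<mu> = \<infinity>"
    \<comment> \<open>Infinite multiplicity would admit every weight \<open>n\<close> on this single
      positive value, against the uniform bound \<open>C\<close>.\<close>
    obtain n where n: "C < real n * p \<mu>" using ex_less_of_nat_mult[OF pos(2)[OF \<mu>]] by blast
    have "(\<Sum>\<mu>\<in>{\<mu>}. real n * p \<mu>) \<le> C" by (rule bound_pos) (use \<mu> inf in auto)
    then show False using n by simp
  qed
  then show "\<forall>\<mu>\<in>?Pos. ?m \<mu> \<noteq> \<infinity>" by blast
  define k where "k = (\<lambda>\<mu>. the_enat (?m \<mu>))"
  have k: "?m \<mu> = enat (k \<mu>)" if "\<mu> \<in> ?Pos" for \<mu>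
    using fin[OF that] by (cases "?m \<mu>") (simp_all add: k_def)
  have k_pos: "1 \<le> k \<mu>" if "\<mu> \<in> ?Pos" for \<mu>
    using m_pos[OF pos(1)[OF that]] unfolding k[OF that] by (simp add: one_enat_def)
  define g where "g = (\<lambda>\<mu>. real (k \<mu>) * p \<mu>)"
  have g_pos: "0 < g \<mu>" if "\<mu> \<in> ?Pos" for \<mu>
    using k_pos[OF that] pos(2)[OF that] by (simp add: g_def)
  have "sum g K \<le> C" if "finite K" "K \<subseteq> ?Pos" for K
    unfolding g_def using that k by (intro bound_pos) auto
  then have summ: "g summable_on ?Pos"
    using g_pos by (intro nonneg_bounded_partial_sums_imp_summable_on[where C = C]
        eventually_finite_subsets_at_top_weakI) (auto intro: less_imp_le)
  define P where "P = infsum g ?Pos"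
  have gP: "(g has_sum P) ?Pos" unfolding P_def using summ by (rule has_sum_infsum)
  have "{\<mu> \<in> ?Pos. g \<mu> \<noteq> 0} = ?Pos" using g_pos by fastforce
  then show "countable ?Pos" using summable_countable_real[OF summ] by simp
  have sum_P: "eigenvalue_sum A \<phi> ?Pos = ereal P"
  proof -
    have "eigenvalue_sum A \<phi> ?Pos = (\<Sum>\<^sub>\<infinity>\<mu>\<in>?Pos. ereal (g \<mu>))"
      unfolding eigenvalue_sum_def using k \<phi>_p pos(1) by (intro infsum_cong) (simp add: g_def)
    then show ?thesis using infsumI[OF has_sum_ereal[OF gP]] by simp
  qed
  then show "eigenvalue_sum A \<phi> ?Pos < \<infinity>" by simp
  let ?N = "eigenvalue_sum A \<phi> (negative_part A \<phi>)"
  \<comment> \<open>Only the upper bound of counts by multiplicities is needed here: the terms are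
    nonpositive, so smaller weights and fewer terms increase the sum. This includes infinite
    multiplicities and a sum equal to \<open>-\<infinity>\<close>.\<close>
  have N_le: "?N \<le> ereal (\<Sum>\<mu>\<in>K. real (count F \<mu>) * p \<mu>)"
    if F: "triangular F" and K: "finite K" "K \<subseteq> negative_part A \<phi>" for F K
  proof -
    have term_le: "ereal_of_enat (?m \<mu>) * \<phi> \<mu> \<le> ereal (real (count F \<mu>) * p \<mu>)"
      if "\<mu> \<in> negative_part A \<phi>" for \<mu>
    proof -
      have "ereal_of_enat (enat (count F \<mu>)) \<le> ereal_of_enat (?m \<mu>)"
        using count_le_multiplicity[OF F] by (simp only: ereal_of_enat_le_iff)
      then have "ereal (real (count F \<mu>)) * (- \<phi> \<mu>) \<le> ereal_of_enat (?m \<mu>) * (- \<phi> \<mu>)"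
        using that by (intro ereal_mult_right_mono) (auto simp: negative_part_def ereal_0_le_uminus_iff intro: less_imp_le)
      then have "ereal_of_enat (?m \<mu>) * \<phi> \<mu> \<le> ereal (real (count F \<mu>)) * \<phi> \<mu>"
        by (simp only: ereal_mult_minus_right ereal_minus_le_minus)
      then show ?thesis using \<phi>_p[OF neg(1)[OF that]] by simp
    qed
    have nonpos: "ereal_of_enat (?m \<mu>) * \<phi> \<mu> \<le> 0" if "\<mu> \<in> negative_part A \<phi>" for \<mu>
      using that by (auto simp: negative_part_def ereal_mult_le_0_iff intro: less_imp_le)
    let ?T = "\<lambda>\<mu>. ereal_of_enat (?m \<mu>) * \<phi> \<mu>"
    have "?N = (INF K\<in>{K. finite K \<and> K \<subseteq> negative_part A \<phi>}. sum ?T K)"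
      unfolding eigenvalue_sum_def by (rule nonpos_infsum_ereal(2)) (rule nonpos)
    also have "\<dots> \<le> sum ?T K" by (rule INF_lower) (use K in blast)
    also have "\<dots> \<le> (\<Sum>\<mu>\<in>K. ereal (real (count F \<mu>) * p \<mu>))"
      using K(2) by (intro sum_mono term_le) blast
    finally show ?thesis by simp
  qed
  have extend: "\<exists>F. triangular F \<and> F1 \<subseteq> F \<and> sum s F \<le> t + \<epsilon>" if F1: "triangular F1" and "0 < \<epsilon>" for F1 \<epsilon>
    using c
  proof
    \<comment> \<open>The enlarged \<open>F\<close> need not be triangular. It serves for
      comparison, since \<open>s \<ge> 0\<close> gives \<open>sum s F1 \<le> sum s F\<close>, and
      \<open>F1\<close> itself is the witness.\<close>
    assume nonneg: "(\<forall>z. 0 \<le> \<phi> z) \<and> (\<forall>u. 0 \<le> s u)"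
    obtain F0 where F0: "finite F0"
      "\<And>F. \<lbrakk>finite F; cinner.orthonormal F; F0 \<subseteq> cspan F\<rbrakk> \<Longrightarrow> sum s F \<le> t + \<epsilon>"
      using approx[OF closure_UNIV \<open>0 < \<epsilon>\<close>] by blast
    obtain F where F: "finite F" "cinner.orthonormal F" "F1 \<subseteq> F" "F0 \<subseteq> cspan F"
      using cinner_Gram_Schmidt[OF triangularD(1,2)[OF F1] F0(1)] .
    have "sum s F1 \<le> sum s F" using nonneg F by (intro sum_mono2) auto
    also have "\<dots> \<le> t + \<epsilon>" by (intro F0 F)
    finally show ?thesis using F1 by blast
  next
    \<comment> \<open>Here the approximating vectors are taken in the dense span of the generalized
      eigenvectors, so they can be absorbed while keeping the set triangular.\<close>
    let ?S = "generalized_eigenvectors A"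
    assume "complete_system ?S"
    then have "closure (cspan ?S) = UNIV" by (simp add: complete_system_def)
    from approx[OF this \<open>0 < \<epsilon>\<close>] obtain F0 where F0: "finite F0" "F0 \<subseteq> cspan ?S"
      "\<forall>F. finite F \<longrightarrow> cinner.orthonormal F \<longrightarrow> F0 \<subseteq> cspan F \<longrightarrow> sum s F \<le> t + \<epsilon>"
      by (elim exE conjE)
    have "\<exists>X. finite X \<and> X \<subseteq> ?S \<and> v \<in> cspan X" if "v \<in> F0" for v
    proof -
      have "v \<in> cspan ?S" using F0(2) that by blast
      from span_finite_subset[OF this] show ?thesis by metis
    qed
    then obtain X where X: "\<And>v. v \<in> F0 \<Longrightarrow> finite (X v) \<and> X v \<subseteq> ?S \<and> v \<in> cspan (X v)" by metis
    have "finite (\<Union>(X ` F0))" using F0(1) X by blast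
    moreover have "\<Union>(X ` F0) \<subseteq> (\<Union>\<mu>\<in>eigenvalues A. gen \<mu>)"
      using X unfolding generalized_eigenvectors_def by blast
    ultimately obtain F where F: "triangular F" "F1 \<subseteq> F" "\<Union>(X ` F0) \<subseteq> cspan F"
      by (rule triangular_extend_finite[OF F1]) blast
    have "F0 \<subseteq> cspan F"
    proof
      fix v assume v: "v \<in> F0"
      have "X v \<subseteq> cspan F" using v F(3) by blast
      then have "cspan (X v) \<subseteq> cspan F" by (rule complex_vs.span_minimal) (rule complex_vs.subspace_span)
      then show "v \<in> cspan F" using X[OF v] by blast
    qed
    then have "sum s F \<le> t + \<epsilon>" by (intro F0(3)[rule_format] triangularD[OF F(1)])
    then show ?thesis using F by blast
  qed
  have "ereal P + ?N \<le> ereal t + ereal \<epsilon>" if "0 < \<epsilon>" for \<epsilon>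
  proof -
    \<comment> \<open>One half of \<open>\<epsilon>\<close> pays for truncating the positive sum to
      \<open>K\<close>, the other for the excess of \<open>sum s F\<close> over
      \<open>t\<close>.\<close>
    have half: "0 < \<epsilon> / 2" using that by simp
    have "\<exists>K. finite K \<and> K \<subseteq> ?Pos \<and> dist (sum g K) P < \<epsilon> / 2"
      using gP half unfolding has_sum_def tendsto_iff eventually_finite_subsets_at_top
      by (meson order_refl)
    then obtain K where K: "finite K" "K \<subseteq> ?Pos" "dist (sum g K) P < \<epsilon> / 2" by blast
    have "enat (k \<mu>) \<le> ?m \<mu>" if "\<mu> \<in> K" for \<mu> using k K(2) that by (simp add: subset_iff)
    then obtain F1 where F1: "triangular F1" "\<And>\<mu>. \<mu> \<in> K \<Longrightarrow> k \<mu> \<le> count F1 \<mu>"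
      by (rule triangular_attains_multiplicity[OF triangular.empty K(1)]) blast+
    obtain F where F: "triangular F" "F1 \<subseteq> F" "sum s F \<le> t + \<epsilon> / 2"
      using extend[OF F1(1) half] by blast
    define L where "L = diag ` F"
    have fL: "finite L" using triangularD(1)[OF F(1)] by (simp add: L_def)
    have L_eig: "\<mu> \<in> eigenvalues A" if "\<mu> \<in> L" for \<mu>
      using triangular_diag_eigenvalue[OF F(1)] that by (auto simp: L_def)
    have kF: "k \<mu> \<le> count F \<mu>" if "\<mu> \<in> K" for \<mu>
      using F1(2)[OF that] count_mono[OF F(2) triangularD(1)[OF F(1)]] by (rule le_trans)
    have KL: "K \<subseteq> L \<inter> ?Pos"
    proof
      fix \<mu> assume \<mu>: "\<mu> \<in> K"
      then have "count F \<mu> \<noteq> 0" using kF[OF \<mu>] k_pos[of \<mu>] K(2) by fastforce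
      then have "{f \<in> F. diag f = \<mu>} \<noteq> {}" unfolding count_def by (metis card.empty)
      then show "\<mu> \<in> L \<inter> ?Pos" using \<mu> K(2) by (auto simp: L_def)
    qed
    let ?h = "\<lambda>\<mu>. real (count F \<mu>) * p \<mu>"
    have "P - \<epsilon> / 2 \<le> sum g K" using K(3) by (simp add: dist_real_def abs_if split: if_splits)
    also have "\<dots> \<le> sum ?h K"
      unfolding g_def using kF pos(2) K(2) by (intro sum_mono mult_right_mono) (auto intro: less_imp_le)
    also have "\<dots> \<le> sum ?h (L \<inter> ?Pos)"
      using KL fL pos(2) by (intro sum_mono2) (auto intro!: mult_nonneg_nonneg intro: less_imp_le)
    finally have 1: "P \<le> sum ?h (L \<inter> ?Pos) + \<epsilon> / 2" by simp
    \<comment> \<open>Diagonal entries with \<open>\<phi> = 0\<close> contribute nothing, so the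
      positive and negative ones account for the whole diagonal.\<close>
    have "sum ?h L = sum ?h ((L \<inter> ?Pos) \<union> (L \<inter> negative_part A \<phi>))"
      using fL L_eig \<phi>_p
      by (intro sum.mono_neutral_right) (auto simp: positive_part_def negative_part_def not_less)
    also have "\<dots> = sum ?h (L \<inter> ?Pos) + sum ?h (L \<inter> negative_part A \<phi>)"
      using fL by (intro sum.union_disjoint) (auto simp: positive_part_def negative_part_def)
    finally have 2: "sum ?h (L \<inter> ?Pos) + sum ?h (L \<inter> negative_part A \<phi>) = (\<Sum>f\<in>F. p (diag f))"
      using sum_diag_eq_sum_count[OF triangularD(1)[OF F(1)] fL, of p] by (simp add: L_def)
    have "ereal P + ?N \<le> ereal P + ereal (sum ?h (L \<inter> negative_part A \<phi>))"
      using fL by (intro add_left_mono N_le F) auto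
    also have "\<dots> \<le> ereal (t + \<epsilon>)"
      using 1 2 sum_diag[OF F(1)] F(3) by simp
    finally show ?thesis by simp
  qed
  then have "ereal P + ?N \<le> ereal t" by (rule ereal_le_epsilon2)
  then show "eigenvalue_sum A \<phi> ?Pos + ?N \<le> ereal t" by (simp only: sum_P)
qed

end

section \<open>The form inequality for quantizations\<close>

context quantization
begin

text \<open>Although \<open>Q_lincomb\<close> gives only an extension of operators, that determines
  the value at a vector where both summands are defined.\<close>

lemma Q_combination:
  assumes "\<sigma> \<in> L" "\<tau> \<in> L" "Q \<sigma> u = Some x" "Q \<tau> u = Some y"
  shows "Q (\<lambda>\<xi>. a * \<sigma> \<xi> + b * \<tau> \<xi>) u = Some (a *\<^sub>C x + b *\<^sub>C y)"
proof -
  have "op_lincomb a (Q \<sigma>) b (Q \<tau>) u = Some (a *\<^sub>C x + b *\<^sub>C y)"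
    using assms(3,4) by (auto simp: op_lincomb_def)
  then show ?thesis using Q_lincomb[OF assms(1,2), of a b] unfolding map_le_def by (metis domI)
qed

lemma combination_mem: "\<sigma> \<in> L \<Longrightarrow> \<tau> \<in> L \<Longrightarrow> (\<lambda>\<xi>. a * \<sigma> \<xi> + b * \<tau> \<xi>) \<in> L"
  by (intro add_mem scale_mem)

lemma Re_mem:
  assumes "\<sigma> \<in> L"
  shows "(\<lambda>\<xi>. complex_of_real (Re (\<sigma> \<xi>))) \<in> L"
proof -
  have "(\<lambda>\<xi>. complex_of_real (Re (\<sigma> \<xi>))) = (\<lambda>\<xi>. (1/2) * \<sigma> \<xi> + (1/2) * cnj (\<sigma> \<xi>))"
    by (simp add: fun_eq_iff complex_eq_iff)
  then show ?thesis using combination_mem[OF assms cnj_mem[OF assms], of "1/2" "1/2"] by simp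
qed

lemma Im_mem:
  assumes "\<sigma> \<in> L"
  shows "(\<lambda>\<xi>. complex_of_real (Im (\<sigma> \<xi>))) \<in> L"
proof -
  have "(\<lambda>\<xi>. complex_of_real (Im (\<sigma> \<xi>))) = (\<lambda>\<xi>. (- \<i>/2) * \<sigma> \<xi> + (\<i>/2) * cnj (\<sigma> \<xi>))"
    by (simp add: fun_eq_iff complex_eq_iff)
  then show ?thesis using combination_mem[OF assms cnj_mem[OF assms], of "-\<i>/2" "\<i>/2"] by simp
qed

lemma Q_affine:
  assumes "\<sigma> \<in> L" "\<tau> \<in> L" "Q \<sigma> u = Some x" "Q \<tau> u = Some y"
  shows "Q (\<lambda>\<xi>. \<sigma> \<xi> + a * \<tau> \<xi> + c) u = Some (x + a *\<^sub>C y + c *\<^sub>C u)"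
proof -
  have "Q (\<lambda>\<xi>. 1 * (1 * \<sigma> \<xi> + a * \<tau> \<xi>) + c * 1) u = Some (1 *\<^sub>C (1 *\<^sub>C x + a *\<^sub>C y) + c *\<^sub>C u)"
    using assms by (intro Q_combination combination_mem const_mem) (simp_all add: Q_one)
  then show ?thesis by (simp add: scaleC_one)
qed

lemma garding_classD:
  assumes "f \<in> garding_class L Q T \<nu>" "Q f u = Some x"
  shows "- \<nu> * Re (cinner (T u) u) \<le> Re (cinner x u)"
proof -
  have "u \<in> dom (Q f)" using assms(2) by blast
  then have "- \<nu> * Re (cinner (T u) u) \<le> Re (cinner (op_apply (Q f) u) u)"
    using assms(1) unfolding garding_class_def by blast
  then show ?thesis using assms(2) by simp
qed

text \<open>The real pairing of \<open>w\<close> with \<open>z = \<alpha> + \<i> * \<beta>\<close>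
  splits into the real part of the form of \<open>Re (w * cnj \<sigma>)\<close> and the imaginary
  part of the form of \<open>Im (w * cnj \<sigma>)\<close>. The class membership bounds the first,
  the condition with \<open>\<nu>1\<close> the second.\<close>

lemma form_inequality_complex:
  assumes hyp: "hypotheses_complex L Q T \<sigma> \<phi> \<nu>1 \<nu>2"
    and comp: "comp_fun \<phi> \<sigma> \<in> L" "Q (comp_fun \<phi> \<sigma>) u = Some b"
    and u: "u \<in> dom (Q \<sigma>)" "norm u = 1"
  defines "z \<equiv> cinner (op_apply (Q \<sigma>) u) u"
  shows "\<phi> z \<noteq> -\<infinity> \<and> \<phi> z \<le> ereal (Re (cinner b u) + (\<nu>1 + \<nu>2) * Re (cinner (T u) u))"
    (is "_ \<and> _ \<le> ereal ?s")
proof -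
  have \<sigma>: "\<sigma> \<in> L" using hyp by (simp add: hypotheses_complex_def)
  define X where "X = (\<lambda>\<xi>. complex_of_real (Re (\<sigma> \<xi>)))"
  define Y where "Y = (\<lambda>\<xi>. complex_of_real (Im (\<sigma> \<xi>)))"
  have XY: "X \<in> L" "Y \<in> L" using Re_mem[OF \<sigma>] Im_mem[OF \<sigma>] by (simp_all add: X_def Y_def)
  \<comment> \<open>The domain condition \<open>dom_Q\<close> makes both parts of the symbol act on
    \<open>u\<close>. Their operators are not assumed symmetric, so \<open>\<alpha>\<close> and
    \<open>\<beta>\<close> may be non-real.\<close>
  obtain x y where x: "Q X u = Some x" and y: "Q Y u = Some y"
    using u(1) dom_Q[OF \<sigma>] unfolding X_def Y_def by blast
  define \<alpha> where "\<alpha> = cinner x u"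
  define \<beta> where "\<beta> = cinner y u"
  have "(\<lambda>\<xi>. 1 * X \<xi> + \<i> * Y \<xi>) = \<sigma>" by (simp add: fun_eq_iff X_def Y_def complex_eq_iff)
  then have "Q \<sigma> u = Some (1 *\<^sub>C x + \<i> *\<^sub>C y)" using Q_combination[OF XY x y, of 1 \<i>] by simp
  then have z: "z = \<alpha> + \<i> * \<beta>"
    by (simp add: z_def \<alpha>_def \<beta>_def cinner_add_left cinner_scaleC_left)
  have zN: "z \<in> numerical_range (Q \<sigma>)" using u unfolding z_def numerical_range_def by blast
  \<comment> \<open>The witness is \<open>a = w \<bullet> z - t\<close>, the value at
    \<open>z\<close> of an affine minorant of \<open>\<phi>\<close> exact up to
    \<open>\<epsilon>\<close>. Its finiteness excludes
    \<open>\<phi> z = -\<infinity>\<close>.\<close>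
  have step: "\<exists>a. ereal a \<le> \<phi> z \<and> \<phi> z - ereal \<epsilon> \<le> ereal a \<and> a \<le> ?s" if eps: "0 < \<epsilon>" for \<epsilon>
  proof -
    obtain t w where tw: "(t, w) \<in> eps_subdifferential \<epsilon> \<phi> z"
      and b1: "\<forall>u\<in>dom (Q \<sigma>). Im (cinner (op_apply (Q (\<lambda>\<xi>. complex_of_real (Im (w * cnj (\<sigma> \<xi>))))) u) u)
          \<le> \<nu>1 * Re (cinner (T u) u)"
      and b2: "(\<lambda>\<xi>. comp_fun \<phi> \<sigma> \<xi> - complex_of_real (Re (w * cnj (\<sigma> \<xi>))) + complex_of_real t)
          \<in> garding_class L Q T \<nu>2"
      using hyp zN eps unfolding hypotheses_complex_def by blast
    define R where "R = (\<lambda>\<xi>. complex_of_real (Re w) * X \<xi> + complex_of_real (Im w) * Y \<xi>)"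
    define J where "J = (\<lambda>\<xi>. complex_of_real (Im w) * X \<xi> + complex_of_real (- Re w) * Y \<xi>)"
    define r where "r = complex_of_real (Re w) *\<^sub>C x + complex_of_real (Im w) *\<^sub>C y"
    define j where "j = complex_of_real (Im w) *\<^sub>C x + complex_of_real (- Re w) *\<^sub>C y"
    have R: "Q R u = Some r" unfolding R_def r_def by (rule Q_combination[OF XY x y])
    have J: "Q J u = Some j" unfolding J_def j_def by (rule Q_combination[OF XY x y])
    have R_eq: "R = (\<lambda>\<xi>. complex_of_real (Re (w * cnj (\<sigma> \<xi>))))"
      by (simp add: fun_eq_iff R_def X_def Y_def complex_eq_iff)
    have J_eq: "J = (\<lambda>\<xi>. complex_of_real (Im (w * cnj (\<sigma> \<xi>))))"
      by (simp add: fun_eq_iff J_def X_def Y_def complex_eq_iff)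
    have "Im (cinner j u) \<le> \<nu>1 * Re (cinner (T u) u)"
      using b1[rule_format, OF u(1)] J unfolding J_eq by simp
    then have 1: "Im w * Im \<alpha> - Re w * Im \<beta> \<le> \<nu>1 * Re (cinner (T u) u)"
      by (simp add: j_def \<alpha>_def \<beta>_def cinner.add_left cinner.diff_left cinner.minus_left cinner.scale_left)
    have "(\<lambda>\<xi>. comp_fun \<phi> \<sigma> \<xi> - R \<xi> + complex_of_real t) \<in> garding_class L Q T \<nu>2"
      using b2 by (simp only: R_eq)
    then have "(\<lambda>\<xi>. comp_fun \<phi> \<sigma> \<xi> + (- 1) * R \<xi> + complex_of_real t) \<in> garding_class L Q T \<nu>2"
      by simp
    moreover have "R \<in> L" unfolding R_def by (intro combination_mem XY)
    ultimately have "- \<nu>2 * Re (cinner (T u) u) \<le> Re (cinner (b + (- 1) *\<^sub>C r + complex_of_real t *\<^sub>C u) u)"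
      using garding_classD Q_affine[OF comp(1) _ comp(2) R] by blast
    then have 2: "Re w * Re \<alpha> + Im w * Re \<beta> - t \<le> Re (cinner b u) + \<nu>2 * Re (cinner (T u) u)"
      using u(2) by (simp add: r_def \<alpha>_def \<beta>_def cinner.add_left cinner.scale_left cinner_self
          cinner.diff_left cinner.minus_left)
    have "w \<bullet> z = (Re w * Re \<alpha> + Im w * Re \<beta>) + (Im w * Im \<alpha> - Re w * Im \<beta>)"
      by (simp add: inner_complex_def z algebra_simps)
    then have "w \<bullet> z - t \<le> ?s" using 1 2 by (simp add: algebra_simps)
    then show ?thesis using tw unfolding eps_subdifferential_def by blast
  qed
  have "\<phi> z \<le> ereal ?s + ereal \<epsilon>" if "0 < \<epsilon>" for \<epsilon>
    using step[OF that] by (cases "\<phi> z") auto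
  then have "\<phi> z \<le> ereal ?s" by (rule ereal_le_epsilon2)
  moreover have "\<phi> z \<noteq> -\<infinity>" using step[of 1] by auto
  ultimately show ?thesis by blast
qed

text \<open>With real \<open>w\<close> and \<open>\<sigma>\<close> the pairing
  \<open>w * Re z\<close> is the real part of the form of \<open>w * \<sigma>\<close> itself, so the
  class membership yields the whole bound, in accordance with \<open>\<nu>1 = 0\<close>.\<close>

lemma form_inequality_real:
  assumes hyp: "hypotheses_real L Q T \<sigma> \<psi> \<nu>2"
    and comp: "comp_fun \<psi> (\<lambda>\<xi>. Re (\<sigma> \<xi>)) \<in> L" "Q (comp_fun \<psi> (\<lambda>\<xi>. Re (\<sigma> \<xi>))) u = Some b"
    and u: "u \<in> dom (Q \<sigma>)" "norm u = 1"
  defines "z \<equiv> cinner (op_apply (Q \<sigma>) u) u"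
  shows "\<psi> (Re z) \<noteq> -\<infinity> \<and> \<psi> (Re z) \<le> ereal (Re (cinner b u) + \<nu>2 * Re (cinner (T u) u))"
    (is "_ \<and> _ \<le> ereal ?s")
proof -
  have \<sigma>: "\<sigma> \<in> L" using hyp by (simp add: hypotheses_real_def real_valued_def)
  obtain x where x: "Q \<sigma> u = Some x" using u(1) by blast
  have z: "z = cinner x u" using x by (simp add: z_def)
  have zN: "z \<in> numerical_range (Q \<sigma>)" using u unfolding z_def numerical_range_def by blast
  have step: "\<exists>a. ereal a \<le> \<psi> (Re z) \<and> \<psi> (Re z) - ereal \<epsilon> \<le> ereal a \<and> a \<le> ?s" if eps: "0 < \<epsilon>" for \<epsilon>
  proof -
    obtain t w where tw: "(t, w) \<in> eps_subdifferential \<epsilon> \<psi> (Re z)"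
      and b2: "(\<lambda>\<xi>. comp_fun \<psi> (\<lambda>\<xi>. Re (\<sigma> \<xi>)) \<xi> - complex_of_real w * \<sigma> \<xi> + complex_of_real t)
          \<in> garding_class L Q T \<nu>2"
      using hyp zN eps unfolding hypotheses_real_def by blast
    from b2 have "(\<lambda>\<xi>. comp_fun \<psi> (\<lambda>\<xi>. Re (\<sigma> \<xi>)) \<xi> + (- complex_of_real w) * \<sigma> \<xi> + complex_of_real t)
        \<in> garding_class L Q T \<nu>2" by simp
    then have "- \<nu>2 * Re (cinner (T u) u) \<le> Re (cinner (b + (- complex_of_real w) *\<^sub>C x + complex_of_real t *\<^sub>C u) u)"
      using garding_classD Q_affine[OF comp(1) \<sigma> comp(2) x] by blast
    then have "w * Re z - t \<le> ?s"
      using u(2) by (simp add: z cinner.add_left cinner.scale_left cinner_self cinner.diff_left cinner.minus_left)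
    then show ?thesis using tw unfolding eps_subdifferential_def by auto
  qed
  have "\<psi> (Re z) \<le> ereal ?s + ereal \<epsilon>" if "0 < \<epsilon>" for \<epsilon>
    using step[OF that] by (cases "\<psi> (Re z)") auto
  then have "\<psi> (Re z) \<le> ereal ?s" by (rule ereal_le_epsilon2)
  moreover have "\<psi> (Re z) \<noteq> -\<infinity>" using step[of 1] by auto
  ultimately show ?thesis by blast
qed

end

text \<open>Scaling removes the normalization, and continuity of the form of a bounded operator
  passes from \<open>D\<close> to its closure.\<close>

lemma form_nonneg_dense:
  assumes A: "bounded_operator A" and D: "closure D = UNIV"
    and scale: "\<And>c u. u \<in> D \<Longrightarrow> c *\<^sub>C u \<in> D"
    and pos: "\<And>u. \<lbrakk>u \<in> D; norm u = 1\<rbrakk> \<Longrightarrow> 0 \<le> Re (cinner (A u) u)"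
  shows "0 \<le> Re (cinner (A u) u)"
proof -
  have "0 \<le> A u \<bullet> u" if "u \<in> D" for u
  proof (cases "u = 0")
    case False
    define v where "v = complex_of_real (1 / norm u) *\<^sub>C u"
    have nv: "norm v = 1" using False unfolding v_def scaleC_of_real by simp
    have "v \<in> D" using scale that by (simp add: v_def)
    then have "0 \<le> Re (cinner (A v) v)" using pos nv by blast
    moreover have "u = complex_of_real (norm u) *\<^sub>C v"
      using False by (simp add: v_def scaleC_scaleC scaleC_one)
    then have "cinner (A u) u = complex_of_real ((norm u)\<^sup>2) * cinner (A v) v"
      by (metis (no_types, opaque_lifting) bounded_operatorD(2)[OF A] cinner.scale_left cinner.scale_right
          complex_cnj_complex_of_real mult.assoc of_real_mult power2_eq_square)
    ultimately show ?thesis by (simp add: inner_eq_Re_cinner)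
  qed simp
  moreover have "closed {u. 0 \<le> A u \<bullet> u}"
    using A unfolding bounded_operator_def
    by (intro closed_Collect_le continuous_intros) (auto intro: linear_continuous_on)
  ultimately have "closure D \<subseteq> {u. 0 \<le> A u \<bullet> u}" by (intro closure_minimal) auto
  then show ?thesis using D by (auto simp: inner_eq_Re_cinner)
qed

section \<open>The trace inequality for quantizations\<close>

theorem theorem7:
  fixes L :: "('x \<Rightarrow> complex) set"
    and Q :: "('x \<Rightarrow> complex) \<Rightarrow> ('h::complex_hilbert \<Rightarrow> 'h option)"
    and T :: "'h \<Rightarrow> 'h"
    and \<sigma> :: "'x \<Rightarrow> complex"
    and \<phi> :: "complex \<Rightarrow> ereal"
    and \<nu>1 \<nu>2 :: real
  assumes separable: "separable_space (euclidean :: 'h topology)"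
    and quantization: "quantization L Q"
    and bounded: "bounded_operator T"
    and dense: "densely_defined (Q \<sigma>)"
    and hypotheses: "hypotheses_complex L Q T \<sigma> \<phi> \<nu>1 \<nu>2 \<or>
      (\<exists>\<psi>::real \<Rightarrow> ereal. \<phi> = (\<lambda>z. \<psi> (Re z)) \<and> hypotheses_real L Q T \<sigma> \<psi> \<nu>2 \<and> \<nu>1 = 0)"
    and comp_finite: "\<forall>\<xi>. \<bar>\<phi> (\<sigma> \<xi>)\<bar> \<noteq> \<infinity>"
    and comp_mem: "comp_fun \<phi> \<sigma> \<in> real_valued L"
    and comp_trace_class: "dom (Q (comp_fun \<phi> \<sigma>)) = UNIV"
      "trace_class (op_apply (Q (comp_fun \<phi> \<sigma>)))"
    and T_trace_class: "trace_class T"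
    and c: "(\<forall>z. 0 \<le> \<phi> z) \<or> complete_system (generalized_eigenvectors (Q \<sigma>))"
  shows "countable (positive_part (Q \<sigma>) \<phi>) \<and>
    (\<forall>\<mu>\<in>positive_part (Q \<sigma>) \<phi>. algebraic_multiplicity (Q \<sigma>) \<mu> \<noteq> \<infinity>) \<and>
    eigenvalue_sum (Q \<sigma>) \<phi> (positive_part (Q \<sigma>) \<phi>) < \<infinity> \<and>
    eigenvalue_sum (Q \<sigma>) \<phi> (positive_part (Q \<sigma>) \<phi>) +
      eigenvalue_sum (Q \<sigma>) \<phi> (negative_part (Q \<sigma>) \<phi>)
      \<le> ereal (Re (op_trace (op_apply (Q (comp_fun \<phi> \<sigma>)))) + (\<nu>1 + \<nu>2) * Re (op_trace T))"
proof -
  interpret quantization L Q by (rule quantization)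
  define B where "B = op_apply (Q (comp_fun \<phi> \<sigma>))"
  define \<nu> where "\<nu> = \<nu>1 + \<nu>2"
  define s where "s = (\<lambda>u. Re (cinner (B u) u) + \<nu> * Re (cinner (T u) u))"
  define t where "t = Re (op_trace B) + \<nu> * Re (op_trace T)"
  have B: "trace_class B" using comp_trace_class(2) by (simp add: B_def)
  have \<sigma>: "\<sigma> \<in> L" using hypotheses by (auto simp: hypotheses_complex_def hypotheses_real_def real_valued_def)
  interpret hilbert_operator "Q \<sigma>" by unfold_locales (rule linear_operator_Q[OF \<sigma>])
  have comp: "comp_fun \<phi> \<sigma> \<in> L" "Q (comp_fun \<phi> \<sigma>) u = Some (B u)" for u
    using comp_mem comp_trace_class(1) unfolding real_valued_def B_def
    by (blast, metis UNIV_I domIff option.collapse)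
  have form: "\<phi> (cinner (ap u) u) \<noteq> -\<infinity> \<and> \<phi> (cinner (ap u) u) \<le> ereal (s u)"
    if u: "u \<in> dom (Q \<sigma>)" "norm u = 1" for u
    using hypotheses
  proof
    assume "hypotheses_complex L Q T \<sigma> \<phi> \<nu>1 \<nu>2"
    then show ?thesis using form_inequality_complex comp u unfolding s_def \<nu>_def by blast
  next
    assume "\<exists>\<psi>::real \<Rightarrow> ereal. \<phi> = (\<lambda>z. \<psi> (Re z)) \<and> hypotheses_real L Q T \<sigma> \<psi> \<nu>2 \<and> \<nu>1 = 0"
    then obtain \<psi> :: "real \<Rightarrow> ereal" where \<psi>: "\<phi> = (\<lambda>z. \<psi> (Re z))" "hypotheses_real L Q T \<sigma> \<psi> \<nu>2" "\<nu>1 = 0"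
      by blast
    have "comp_fun \<phi> \<sigma> = comp_fun \<psi> (\<lambda>\<xi>. Re (\<sigma> \<xi>))" by (simp add: comp_fun_def \<psi>(1))
    then show ?thesis
      using form_inequality_real[OF \<psi>(2), of u "B u"] comp u by (simp add: s_def \<nu>_def \<psi>(1,3))
  qed
  have sum_s: "sum s F = Re (\<Sum>f\<in>F. cinner (B f) f) + \<nu> * Re (\<Sum>f\<in>F. cinner (T f) f)" for F
    by (simp add: s_def sum.distrib sum_distrib_left)
  obtain C1 where C1: "\<And>F. \<lbrakk>finite F; cinner.orthonormal F\<rbrakk> \<Longrightarrow> norm (\<Sum>f\<in>F. cinner (B f) f) \<le> C1"
    by (rule trace_class_bound[OF separable B]) blast
  obtain C2 where C2: "\<And>F. \<lbrakk>finite F; cinner.orthonormal F\<rbrakk> \<Longrightarrow> norm (\<Sum>f\<in>F. cinner (T f) f) \<le> C2"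
    by (rule trace_class_bound[OF separable T_trace_class]) blast
  \<comment> \<open>The sign of \<open>\<nu>\<close> is unrestricted, so estimates for
    \<open>T\<close> are two-sided and enter with \<open>\<bar>\<nu>\<bar>\<close>.\<close>
  have Re_mult_le: "\<nu> * Re x \<le> \<bar>\<nu>\<bar> * norm x" for x
  proof -
    have "\<nu> * Re x \<le> \<bar>\<nu>\<bar> * \<bar>Re x\<bar>" unfolding abs_mult[symmetric] by (rule abs_ge_self)
    also have "\<dots> \<le> \<bar>\<nu>\<bar> * norm x" by (intro mult_left_mono abs_Re_le_cmod abs_ge_zero)
    finally show ?thesis .
  qed
  have bound: "sum s F \<le> C1 + \<bar>\<nu>\<bar> * C2" if "finite F" "cinner.orthonormal F" for F
    unfolding sum_s
  proof (rule add_mono)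
    show "Re (\<Sum>f\<in>F. cinner (B f) f) \<le> C1" using C1[OF that] complex_Re_le_cmod order_trans by blast
    show "\<nu> * Re (\<Sum>f\<in>F. cinner (T f) f) \<le> \<bar>\<nu>\<bar> * C2"
      using Re_mult_le mult_left_mono[OF C2[OF that] abs_ge_zero] order_trans by blast
  qed
  have approx: "\<exists>F0. finite F0 \<and> F0 \<subseteq> D \<and>
      (\<forall>F. finite F \<longrightarrow> cinner.orthonormal F \<longrightarrow> F0 \<subseteq> cspan F \<longrightarrow> sum s F \<le> t + \<epsilon>)"
    if D: "closure D = UNIV" and "0 < \<epsilon>" for D \<epsilon>
  proof -
    \<comment> \<open>The errors for \<open>B\<close> and \<open>T\<close> enter with factors 1 and
      \<open>\<bar>\<nu>\<bar>\<close>; this choice bounds their total by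
      \<open>\<epsilon>\<close>.\<close>
    define \<delta> where "\<delta> = \<epsilon> / (1 + \<bar>\<nu>\<bar>)"
    have \<delta>: "0 < \<delta>" using \<open>0 < \<epsilon>\<close> by (simp add: \<delta>_def add_pos_nonneg)
    have "1 + \<bar>\<nu>\<bar> \<noteq> 0" by (rule less_imp_neq[symmetric]) (simp add: add_pos_nonneg)
    then have "\<delta> * (1 + \<bar>\<nu>\<bar>) = \<epsilon>" by (simp add: \<delta>_def)
    then have \<delta>\<epsilon>: "\<delta> + \<bar>\<nu>\<bar> * \<delta> = \<epsilon>" by (simp add: algebra_simps)
    obtain F1 where F1: "finite F1" "F1 \<subseteq> D" "\<And>F. \<lbrakk>finite F; cinner.orthonormal F; F1 \<subseteq> cspan F\<rbrakk> \<Longrightarrow>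
        norm ((\<Sum>f\<in>F. cinner (B f) f) - op_trace B) < \<delta>"
      by (rule trace_class_approx[OF separable B D \<delta>]) blast
    obtain F2 where F2: "finite F2" "F2 \<subseteq> D" "\<And>F. \<lbrakk>finite F; cinner.orthonormal F; F2 \<subseteq> cspan F\<rbrakk> \<Longrightarrow>
        norm ((\<Sum>f\<in>F. cinner (T f) f) - op_trace T) < \<delta>"
      by (rule trace_class_approx[OF separable T_trace_class D \<delta>]) blast
    have "sum s F \<le> t + \<epsilon>" if F: "finite F" "cinner.orthonormal F" "F1 \<union> F2 \<subseteq> cspan F" for F
    proof -
      define x where "x = (\<Sum>f\<in>F. cinner (B f) f) - op_trace B"
      define y where "y = (\<Sum>f\<in>F. cinner (T f) f) - op_trace T"
      have "Re x \<le> norm x" by (rule complex_Re_le_cmod)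
      also have "\<dots> \<le> \<delta>" using F1(3)[OF F(1,2)] F(3) by (simp add: x_def less_imp_le)
      finally have "Re x \<le> \<delta>" .
      moreover have "norm y \<le> \<delta>" using F2(3)[OF F(1,2)] F(3) by (simp add: y_def less_imp_le)
      then have "\<nu> * Re y \<le> \<bar>\<nu>\<bar> * \<delta>"
        using Re_mult_le[of y] mult_left_mono[OF _ abs_ge_zero[of \<nu>]] order_trans by blast
      moreover have "sum s F = t + Re x + \<nu> * Re y"
        by (simp add: sum_s t_def x_def y_def algebra_simps)
      ultimately show ?thesis using \<delta>\<epsilon> by linarith
    qed
    then show ?thesis using F1(1,2) F2(1,2) by (intro exI[of _ "F1 \<union> F2"]) simp
  qed
  \<comment> \<open>The inequality \<open>form\<close> gives \<open>0 \<le> \<phi> \<le> s\<close>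
    only at unit vectors of the domain. Density extends \<open>0 \<le> s\<close> to all vectors, as
    the comparison with arbitrary orthonormal sets requires.\<close>
  have s_nonneg: "0 \<le> s u" if "\<forall>z. 0 \<le> \<phi> z" for u
  proof -
    define S where "S = (\<lambda>u. B u + complex_of_real \<nu> *\<^sub>C T u)"
    have S: "bounded_operator S"
      using B bounded unfolding S_def trace_class_def bounded_operator_def
      by (auto intro!: bounded_linear_add bounded_linear_const_scaleR
          simp: scaleC_of_real scaleC_add_right scaleC_scaleC)
        (metis mult.commute scaleC_of_real scaleC_scaleC)
    have S_eq: "Re (cinner (S u) u) = s u" for u
      by (simp add: S_def s_def cinner_add_left cinner_scaleC_left)
    have "0 \<le> Re (cinner (S u) u)"
    proof (rule form_nonneg_dense[OF S])
      show "closure (dom (Q \<sigma>)) = UNIV" using dense by (simp add: densely_defined_def)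
      show "0 \<le> Re (cinner (S u) u)" if "u \<in> dom (Q \<sigma>)" "norm u = 1" for u
      proof -
        have "0 \<le> ereal (s u)" using form[OF that] \<open>\<forall>z. 0 \<le> \<phi> z\<close> order_trans by blast
        then show ?thesis by (simp add: S_eq)
      qed
    qed (rule dom_closed(3))
    then show ?thesis by (simp add: S_eq)
  qed
  have "((\<forall>z. 0 \<le> \<phi> z) \<and> (\<forall>u. 0 \<le> s u)) \<or> complete_system (generalized_eigenvectors (Q \<sigma>))"
    using c s_nonneg by blast
  from trace_inequality[OF form bound approx this]
  show ?thesis unfolding t_def B_def \<nu>_def by blast
qed

end
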